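(* Let $(\mathbb H,\langle\cdot,\cdot\rangle,\|\cdot\|)$ be a separable Hilbert space and let $(L,\mathscr D(L))$ be a densely defined linear operator generating a $C_0$-contraction semigroup $P_t=e^{tL}$ on $\mathbb H$. Let $\mathscr D$ be a core of $(L,\mathscr D(L))$ such that $L=S-A$ on $\mathscr D$, with $S$ symmetric and $A$ antisymmetric on $\mathscr D$; let $(S,\mathscr D(S))$ and $(A,\mathscr D(A))$ denote the closures of $(S,\mathscr D)$ and $(A,\mathscr D)$. Let $\mathbb H=\mathbb H_1\oplus\mathbb H_2$ be an orthogonal decomposition with orthogonal projections $\pi_i:\mathbb H\to\mathbb H_i$, $i=1,2$. Let $\Psi:\mathbb H\to[0,\infty]$ be a functional such that $\{f\in\mathbb H:\Psi(f)<\infty\}$ is dense in $\mathbb H$. With $G:=(A\pi_1)^*A\pi_1$ and the bounded operator $B$ extending $(I+G)^{-1}(A\pi_1)^*$ (see context), assume: (H1) $\mathbb H_1\subset\{f\in\mathscr D(S):Sf=0\}$. (H2) $\pi_1\mathscr D\subset\mathscr D(A)$ and $\pi_1A\pi_1f=0$ for all $f\in\mathscr D$. (H3) $\mathscr D\subset\mathscr D(G)$, and there exists a constant $N\ge1$ such that for all $f\in\mathscr D$ $$\langle BS\pi_2f,\pi_1f\rangle\le\frac N2\|\pi_1f\|\cdot\|\pi_2f\|,\qquad -\langle BA\pi_2f,\pi_1f\rangle\le\frac N2\|\pi_1f\|\cdot\|\pi_2f\|.$$ (H4) For any $f\in\mathscr D(L)$ there exists a sequence $\{f_n\}_{n\ge1}\subset\mathscr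 D$ such that $f_n\to f$ in $\mathbb H$, $\limsup_{n\to\infty}\langle-Lf_n,f_n\rangle\le\langle-Lf,f\rangle$ and $\limsup_{n\to\infty}\Psi(f_n)\le\Psi(f)$. Assume further that $$\Psi(P_tf)\le\Psi(f),\qquad\Psi(e^{-tG}f)\le\Psi(f),\qquad\Psi(\pi_1f)\le\Psi(f),\qquad f\in\mathbb H,\ t\ge0,$$ and that the weak Poincaré inequalities $$\|\pi_1f\|^2\le\alpha_1(r)\|A\pi_1f\|^2+r\Psi(\pi_1f),\qquad r>0,\ f\in\mathscr D(A\pi_1),$$ $$\|\pi_2f\|^2\le\alpha_2(r)\langle-Sf,f\rangle+r\Psi(f),\qquad r>0,\ f\in\mathscr D,$$ hold for some decreasing functions $\alpha_i:(0,\infty)\to[1,\infty)$, $i=1,2$. Then there exist constants $c_1,c_2>0$ such that $$\|P_tf\|^2\le\xi(t)\big(\|f\|^2+\Psi(f)\big),\qquad t\ge0,\ f\in\mathscr D(L),$$ holds for $$\xi(t):=c_1\inf\Big\{r>0:\ c_2t\ge\alpha_1(r)^2\,\alpha_2\Big(\frac r{\alpha_1(r)^2}\Big)\log\frac1r\Big\},$$ and $\xi(t)\to0$ as $t\to\infty$.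
   Context: Operators: (H1) gives $\pi_2\mathscr D\subset\mathscr D(S)$ and (H2) gives $\pi_2\mathscr D\subset\mathscr D(A)$. Under (H2), the operator $A\pi_1$ with domain $\mathscr D(A\pi_1):=\{f\in\mathbb H:\pi_1f\in\mathscr D(A)\}$ is densely defined and closed; its adjoint $(A\pi_1)^*$ equals $-\pi_1A$ on $\mathscr D$. The operator $G:=(A\pi_1)^*A\pi_1$ with domain $\mathscr D(G)=\{f\in\mathscr D(A\pi_1):A\pi_1f\in\mathscr D((A\pi_1)^* )\}$ is self-adjoint and non-negative, and $I+G$ has a bounded inverse defined on all of $\mathbb H$; $e^{-tG}$ is the contraction semigroup generated by $-G$. The operator $B:=(I+G)^{-1}(A\pi_1)^*$, defined on $\mathscr D((A\pi_1)^* )$, is bounded, and $B$ also denotes its unique extension to a bounded linear operator on $\mathbb H$. *)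

theory Defs
  imports "HOL-Analysis.Analysis"
begin

text \<open>
  A possibly unbounded, partially defined operator is represented by its graph.  Its domain is
  the library's \<^const>\<open>Domain\<close>, its closure is the topological \<^const>\<open>closure\<close> of the graph in the
  product space, composition is relational composition (\<open>T O U\<close> applies \<open>T\<close> first), and
  inversion is the relational converse.
\<close>

type_synonym 'h operator = "('h \<times> 'h) set"

definition linear_operator :: "'h::real_vector operator \<Rightarrow> bool" where
  "linear_operator T \<longleftrightarrow> subspace T \<and> single_valued T"

text \<open>Meaningful for single-valued \<open>T\<close> and \<open>f \<in> Domain T\<close> only.\<close>

definition app :: "'h operator \<Rightarrow> 'h \<Rightarrow> 'h" where
  "app T f = (THE g. (f, g) \<in> T)"

definition restrict_op :: "'h operator \<Rightarrow> 'h set \<Rightarrow> 'h operator" where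
  "restrict_op T D = {(f, g) \<in> T. f \<in> D}"

definition neg_op :: "'h::ab_group_add operator \<Rightarrow> 'h operator" where
  "neg_op T = {(f, - g) | f g. (f, g) \<in> T}"

definition id_plus :: "'h::ab_group_add operator \<Rightarrow> 'h operator" where
  "id_plus T = {(f, f + g) | f g. (f, g) \<in> T}"

definition precomp :: "'h operator \<Rightarrow> ('h \<Rightarrow> 'h) \<Rightarrow> 'h operator" where
  "precomp T p = {(f, g). (p f, g) \<in> T}"

text \<open>Single-valued exactly when \<open>T\<close> is densely defined.\<close>

definition adjoint_op :: "'h::real_inner operator \<Rightarrow> 'h operator" where
  "adjoint_op T = {(g, h). \<forall>(f, k) \<in> T. k \<bullet> g = f \<bullet> h}"

definition symmetric_op :: "'h::real_inner operator \<Rightarrow> bool" where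
  "symmetric_op T \<longleftrightarrow> (\<forall>f \<in> Domain T. \<forall>g \<in> Domain T. app T f \<bullet> g = f \<bullet> app T g)"

definition antisymmetric_op :: "'h::real_inner operator \<Rightarrow> bool" where
  "antisymmetric_op T \<longleftrightarrow> (\<forall>f \<in> Domain T. \<forall>g \<in> Domain T. app T f \<bullet> g = - (f \<bullet> app T g))"

definition core_of :: "'h::real_normed_vector set \<Rightarrow> 'h operator \<Rightarrow> bool" where
  "core_of D T \<longleftrightarrow> subspace D \<and> D \<subseteq> Domain T \<and> closure (restrict_op T D) = T"

text \<open>The unique everywhere defined bounded extension of a densely defined bounded operator.\<close>

definition bounded_extension :: "'h::real_normed_vector operator \<Rightarrow> 'h \<Rightarrow> 'h" where
  "bounded_extension T = (THE B. bounded_linear B \<and> (\<forall>(f, g) \<in> T. B f = g))"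

definition C0_contraction_semigroup :: "(real \<Rightarrow> 'h::real_normed_vector \<Rightarrow> 'h) \<Rightarrow> bool" where
  "C0_contraction_semigroup P \<longleftrightarrow>
     (\<forall>t\<ge>0. bounded_linear (P t)) \<and>
     (\<forall>t\<ge>0. \<forall>f. norm (P t f) \<le> norm f) \<and>
     (\<forall>f. P 0 f = f) \<and>
     (\<forall>s\<ge>0. \<forall>t\<ge>0. \<forall>f. P (s + t) f = P s (P t f)) \<and>
     (\<forall>f. ((\<lambda>t. P t f) \<longlongrightarrow> f) (at_right 0))"

definition generator :: "(real \<Rightarrow> 'h::real_normed_vector \<Rightarrow> 'h) \<Rightarrow> 'h operator" where
  "generator P = {(f, g). ((\<lambda>t. (P t f - f) /\<^sub>R t) \<longlongrightarrow> g) (at_right 0)}"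

definition generates_semigroup ::
  "'h::real_normed_vector operator \<Rightarrow> (real \<Rightarrow> 'h \<Rightarrow> 'h) \<Rightarrow> bool" where
  "generates_semigroup T P \<longleftrightarrow> C0_contraction_semigroup P \<and> generator P = T"

text \<open>
  The semigroup \<open>e\<^sup>t\<^sup>T\<close> generated by \<open>T\<close>, for \<open>t \<ge> 0\<close>.  The description is taken pointwise,
  since \<^const>\<open>generates_semigroup\<close> leaves the values at negative times arbitrary.
\<close>

definition exp_semigroup :: "'h::real_normed_vector operator \<Rightarrow> real \<Rightarrow> 'h \<Rightarrow> 'h" where
  "exp_semigroup T t f = (THE g. \<exists>P. generates_semigroup T P \<and> g = P t f)"

text \<open>
  The conditions determine the projections and force both summands to be closed (each is the
  orthogonal complement of the other).
\<close>

definition orthogonal_decomposition ::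
  "'h::real_inner set \<Rightarrow> 'h set \<Rightarrow> ('h \<Rightarrow> 'h) \<Rightarrow> ('h \<Rightarrow> 'h) \<Rightarrow> bool" where
  "orthogonal_decomposition H1 H2 p1 p2 \<longleftrightarrow>
     subspace H1 \<and> subspace H2 \<and>
     (\<forall>f \<in> H1. \<forall>g \<in> H2. orthogonal f g) \<and>
     (\<forall>f. p1 f \<in> H1 \<and> p2 f \<in> H2 \<and> f = p1 f + p2 f)"

text \<open>
  Every \<open>r \<ge> 1\<close> belongs to the set whose infimum is taken when \<open>t \<ge> 0\<close>, so the real-valued
  infimum is over a nonempty set bounded below.
\<close>

definition rate ::
  "(real \<Rightarrow> real) \<Rightarrow> (real \<Rightarrow> real) \<Rightarrow> real \<Rightarrow> real \<Rightarrow> real \<Rightarrow> real" where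
  "rate \<alpha>1 \<alpha>2 c1 c2 t =
     c1 * Inf {r. r > 0 \<and> c2 * t \<ge> (\<alpha>1 r)\<^sup>2 * \<alpha>2 (r / (\<alpha>1 r)\<^sup>2) * ln (1 / r)}"

end

theory Submission
  imports Defs
begin

text \<open>
  The decay of \<open>P\<^sub>t f\<close> is read off the modified energy \<open>F = \<parallel>f\<parallel>\<^sup>2 / 2 + \<delta> \<langle>B f, f\<rangle>\<close>.  On the core, \<open>L = S - A\<close>
  dissipates only the component \<open>\<pi>\<^sub>2 f\<close>, while the derivative of \<open>\<langle>B f, f\<rangle>\<close> contributes
  \<open>- \<langle>(I + G)\<^sup>-\<^sup>1 G f, f\<rangle>\<close>, which controls \<open>\<pi>\<^sub>1 f\<close>: comparing the resolvent with the semigroup \<open>e\<^sup>-\<^sup>t\<^sup>G\<close>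
  turns the first weak Poincare inequality into a lower bound for this term.  With \<open>\<delta>\<close> of order
  \<open>1 / (\<alpha>\<^sub>1 \<alpha>\<^sub>2)\<close> and the second inequality taken at level \<open>r / \<alpha>\<^sub>1\<^sup>2\<close>, all error terms are absorbed and
  \<open>F' \<le> \<kappa> (C r \<Psi>(f) - F)\<close> with \<open>\<kappa>\<close> of order \<open>1 / (\<alpha>\<^sub>1\<^sup>2 \<alpha>\<^sub>2)\<close>, so Gronwall's inequality concludes.

  The semigroup \<open>e\<^sup>-\<^sup>t\<^sup>G\<close> is constructed by Yosida approximation; with \<open>T = A \<pi>\<^sub>1\<close>, the operator
  \<open>G = T\<^sup>* T\<close> is m-accretive because of the
  orthogonal projection of \<open>H \<times> H\<close> onto the graph of \<open>T\<close>.
\<close>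

section \<open>Differential inequalities on the half-line\<close>

text \<open>The obstacle is that \<open>\<Psi>\<close> has no continuity, so an inequality
  containing it does not pass from the core to \<open>Domain L\<close> by closing a graph; (H4)
  takes the place of continuity. The bound on the derivative of <B f, f> is free of
  \<open>\<Psi>\<close> and does close along the graph. So this bound and the two weak Poincare
  inequalities are extended separately and meet only on the orbit. The mixed term works because A
  pi1 maps into H2 and its adjoint into H1, so that \<open>B\<close> takes values in H1. By (H1)
  this kills <B f, S f>, while -<B f, A f> costs at most |pi2 f|^2. The level r / \<alpha>1^2 comes
  from the absorption: there the second inequality enters with a weight of order \<alpha>1^2, so its
  error is again of order r. The energy lies between |f|^2 / 4 and |f|^2, whence the constant 128
  N^2 = 4 * 32 N^2, and 1 / (30 N^2) is the numerical part of \<kappa>. The estimate is proved for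
  each admissible r separately; the infimum is taken only at the end.\<close>

lemma halfline_antimono:
  fixes g :: "real \<Rightarrow> real"
  assumes deriv: "\<And>t. t \<ge> 0 \<Longrightarrow> (g has_real_derivative g' t) (at t within {0..})"
    and nonpos: "\<And>t. t \<ge> 0 \<Longrightarrow> g' t \<le> 0"
    and "0 \<le> s" "s \<le> t"
  shows "g t \<le> g s"
proof (rule DERIV_nonpos_imp_decreasing_open[OF \<open>s \<le> t\<close>])
  fix x assume x: "s < x" "x < t"
  have "at x within {0..} = at x"
    using x \<open>0 \<le> s\<close> by (intro at_within_interior) (auto simp: interior_Ici[of "-1"])
  then show "\<exists>y. (g has_real_derivative y) (at x) \<and> y \<le> 0"
    using deriv[of x] nonpos[of x] x \<open>0 \<le> s\<close> by auto
next
  have "continuous_on {0..} g"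
    using deriv by (auto simp: continuous_on_eq_continuous_within intro: DERIV_continuous)
  then show "continuous_on {s..t} g"
    by (rule continuous_on_subset) (use \<open>0 \<le> s\<close> in auto)
qed

lemma halfline_gronwall:
  fixes g :: "real \<Rightarrow> real"
  assumes deriv: "\<And>t. t \<ge> 0 \<Longrightarrow> (g has_real_derivative g' t) (at t within {0..})"
    and bound: "\<And>t. t \<ge> 0 \<Longrightarrow> g' t \<le> k * (m - g t)"
    and "0 \<le> t"
  shows "g t \<le> m + exp (- k * t) * (g 0 - m)"
proof -
  let ?w = "\<lambda>t. exp (k * t) * (g t - m)"
  have "?w t \<le> ?w 0"
  proof (rule halfline_antimono[of ?w "\<lambda>t. exp (k * t) * (g' t - k * (m - g t))"])
    fix t :: real assume "t \<ge> 0"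
    show "(?w has_real_derivative exp (k * t) * (g' t - k * (m - g t))) (at t within {0..})"
      by (rule derivative_eq_intros deriv[OF \<open>t \<ge> 0\<close>] refl | simp add: algebra_simps)+
    show "exp (k * t) * (g' t - k * (m - g t)) \<le> 0"
      using bound[OF \<open>t \<ge> 0\<close>] by (simp add: mult_le_0_iff)
  qed (use \<open>0 \<le> t\<close> in auto)
  then have "exp (- k * t) * ?w t \<le> exp (- k * t) * (g 0 - m)"
    by (intro mult_left_mono) auto
  moreover have "exp (- k * t) * ?w t = g t - m"
    using exp_add[of "- k * t" "k * t"] by (simp flip: mult.assoc)
  ultimately show ?thesis by linarith
qed

lemma norm_square_derivative:
  fixes u :: "real \<Rightarrow> 'h::real_inner"
  assumes "(u has_vector_derivative u') (at t within X)"
  shows "((\<lambda>t. (norm (u t))\<^sup>2) has_real_derivative 2 * (u t \<bullet> u')) (at t within X)"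
proof -
  have "((\<lambda>t. u t \<bullet> u t) has_vector_derivative u t \<bullet> u' + u' \<bullet> u t) (at t within X)"
    by (rule bounded_bilinear.has_vector_derivative[OF bounded_bilinear_inner assms assms])
  moreover have "u t \<bullet> u' + u' \<bullet> u t = 2 * (u t \<bullet> u')"
    by (simp add: inner_commute)
  ultimately show ?thesis
    unfolding power2_norm_eq_inner has_real_derivative_iff_has_vector_derivative by simp
qed

section \<open>Contraction semigroups\<close>

lemma
  assumes "C0_contraction_semigroup P"
  shows C0_bounded_linear: "t \<ge> 0 \<Longrightarrow> bounded_linear (P t)"
    and C0_norm_le: "t \<ge> 0 \<Longrightarrow> norm (P t f) \<le> norm f"
    and C0_zero: "P 0 f = f"
    and C0_add: "s \<ge> 0 \<Longrightarrow> t \<ge> 0 \<Longrightarrow> P (s + t) f = P s (P t f)"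
    and C0_tendsto: "((\<lambda>t. P t f) \<longlongrightarrow> f) (at_right 0)"
  using assms by (simp_all add: C0_contraction_semigroup_def)

lemma generator_invariant:
  assumes P: "C0_contraction_semigroup P" and fg: "(f, g) \<in> generator P" and t: "t \<ge> 0"
  shows "(P t f, P t g) \<in> generator P"
proof -
  interpret bounded_linear "P t" by (rule C0_bounded_linear[OF P t])
  have "((\<lambda>s. P t ((P s f - f) /\<^sub>R s)) \<longlongrightarrow> P t g) (at_right 0)"
    using fg by (intro tendsto) (simp add: generator_def)
  moreover have "\<forall>\<^sub>F s in at_right 0. P t ((P s f - f) /\<^sub>R s) = (P s (P t f) - P t f) /\<^sub>R s"
  proof (rule eventually_at_right_less[THEN eventually_mono])
    fix s :: real assume "0 < s"
    then have "P s (P t f) = P t (P s f)"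
      using C0_add[OF P, of s t f] C0_add[OF P, of t s f] t by (simp add: add.commute)
    then show "P t ((P s f - f) /\<^sub>R s) = (P s (P t f) - P t f) /\<^sub>R s"
      by (simp add: scaleR diff)
  qed
  ultimately have "((\<lambda>s. (P s (P t f) - P t f) /\<^sub>R s) \<longlongrightarrow> P t g) (at_right 0)"
    by (rule Lim_transform_eventually)
  then show ?thesis by (simp add: generator_def)
qed

text \<open>\<open>generator\<close> records only the right derivative at 0. To the right of
  \<open>t\<close>, the operator \<open>P t\<close> is factored out of the difference quotient; to
  the left, \<open>P s\<close> is, which leaves the additional error \<open>P (t - s) g - g\<close>.
  Contractivity bounds both cases by one function \<open>?q\<close> of the distance.\<close>

lemma semigroup_derivative:
  assumes P: "C0_contraction_semigroup P" and fg: "(f, g) \<in> generator P" and t: "t \<ge> 0"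
  shows "((\<lambda>s. P s f) has_vector_derivative P t g) (at t within {0..})"
proof -
  let ?q = "\<lambda>h. norm ((P h f - f) /\<^sub>R h - g) + norm (P h g - g)"
  have bound: "norm ((P s f - P t f) /\<^sub>R (s - t) - P t g) \<le> ?q \<bar>s - t\<bar>"
    if s: "s \<ge> 0" "s \<noteq> t" for s
  proof (cases "t < s")
    case True
    interpret bounded_linear "P t" by (rule C0_bounded_linear[OF P t])
    have "P s f = P t (P (s - t) f)" using C0_add[OF P t, of "s - t" f] True by simp
    then have "(P s f - P t f) /\<^sub>R (s - t) - P t g = P t ((P (s - t) f - f) /\<^sub>R (s - t) - g)"
      by (simp add: scaleR diff)
    also have "norm \<dots> \<le> norm ((P (s - t) f - f) /\<^sub>R (s - t) - g)"
      by (rule C0_norm_le[OF P t])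
    finally show ?thesis using True
      by (smt (verit, best) norm_ge_zero)
  next
    case False
    then have st: "s < t" using s by simp
    interpret bounded_linear "P s" by (rule C0_bounded_linear[OF P s(1)])
    have eq: "P t h = P s (P (t - s) h)" for h using C0_add[OF P s(1), of "t - s" h] st by simp
    have "(P s f - P t f) /\<^sub>R (s - t) - P t g
        = - (inverse (s - t) *\<^sub>R P s (P (t - s) f - f)) - P s (P (t - s) g)"
      by (simp add: eq diff scaleR_diff_right)
    also have "- (inverse (s - t) *\<^sub>R P s (P (t - s) f - f)) = inverse (t - s) *\<^sub>R P s (P (t - s) f - f)"
      by (metis inverse_minus_eq minus_diff_eq scaleR_minus_left)
    also have "\<dots> - P s (P (t - s) g)
        = P s ((P (t - s) f - f) /\<^sub>R (t - s) - g) - P s (P (t - s) g - g)"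
      by (simp add: scaleR diff)
    finally show ?thesis
      using C0_norm_le[OF P s(1), of "(P (t - s) f - f) /\<^sub>R (t - s) - g"]
        C0_norm_le[OF P s(1), of "P (t - s) g - g"] st
      by (smt (verit, best) norm_triangle_ineq4)
  qed
  have "(?q \<longlongrightarrow> norm (g - g) + norm (g - g)) (at_right 0)"
    using fg C0_tendsto[OF P] by (intro tendsto_intros) (auto simp: generator_def)
  then have q: "(?q \<longlongrightarrow> 0) (at_right 0)" by simp
  have "filterlim (\<lambda>s. \<bar>s - t\<bar>) (at_right 0) (at t within {0..})"
    unfolding filterlim_at by (auto simp: eventually_at_filter intro!: tendsto_eq_intros)
  from filterlim_compose[OF q this] have "((\<lambda>s. ?q \<bar>s - t\<bar>) \<longlongrightarrow> 0) (at t within {0..})" .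
  then have "((\<lambda>s. norm (P s f - P t f - (s - t) *\<^sub>R P t g) / norm (s - t)) \<longlongrightarrow> 0) (at t within {0..})"
  proof (rule Lim_null_comparison[rotated])
    have "norm (norm (P s f - P t f - (s - t) *\<^sub>R P t g) / norm (s - t)) \<le> ?q \<bar>s - t\<bar>"
      if s: "s \<ge> 0" "s \<noteq> t" for s
    proof -
      have "P s f - P t f - (s - t) *\<^sub>R P t g = (s - t) *\<^sub>R ((P s f - P t f) /\<^sub>R (s - t) - P t g)"
        using s by (simp add: scaleR_diff_right)
      then have "norm (P s f - P t f - (s - t) *\<^sub>R P t g) / norm (s - t)
          = norm ((P s f - P t f) /\<^sub>R (s - t) - P t g)"
        using s by simp
      then show ?thesis using bound[OF s] by (simp only: norm_divide real_norm_def abs_norm_cancel abs_abs)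
    qed
    then show "\<forall>\<^sub>F s in at t within {0..}.
        norm (norm (P s f - P t f - (s - t) *\<^sub>R P t g) / norm (s - t)) \<le> ?q \<bar>s - t\<bar>"
      unfolding eventually_at_filter by (intro always_eventually) blast
  qed
  then show ?thesis
    by (simp add: has_vector_derivative_def has_derivative_iff_norm bounded_linear_scaleR_left)
qed

lemma generator_dissipative:
  fixes f :: "'h::real_inner"
  assumes P: "C0_contraction_semigroup P" and fg: "(f, g) \<in> generator P"
  shows "f \<bullet> g \<le> 0"
proof (rule tendsto_upperbound)
  show "((\<lambda>t. f \<bullet> ((P t f - f) /\<^sub>R t)) \<longlongrightarrow> f \<bullet> g) (at_right 0)"
    using fg by (intro tendsto_intros) (simp add: generator_def)
  show "\<forall>\<^sub>F t in at_right 0. f \<bullet> ((P t f - f) /\<^sub>R t) \<le> 0"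
  proof (rule eventually_at_right_less[THEN eventually_mono])
    fix t :: real assume t: "0 < t"
    have "f \<bullet> P t f \<le> norm f * norm (P t f)" by (rule norm_cauchy_schwarz)
    also have "\<dots> \<le> norm f * norm f"
      using C0_norm_le[OF P, of t f] t by (intro mult_left_mono) auto
    finally have "f \<bullet> (P t f - f) \<le> 0"
      by (simp add: inner_diff_right power2_norm_eq_inner[symmetric] power2_eq_square)
    then show "f \<bullet> ((P t f - f) /\<^sub>R t) \<le> 0" using t by (simp add: mult_le_0_iff)
  qed
qed simp

lemma generator_subspace: "C0_contraction_semigroup P \<Longrightarrow> subspace (generator P)"
proof -
  assume P: "C0_contraction_semigroup P"
  have add: "\<forall>\<^sub>F t in at_right 0. P t (f + g) = P t f + P t g" for f g
    by (rule eventually_at_right_less[THEN eventually_mono])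
      (use C0_bounded_linear[OF P] in \<open>simp add: linear_add bounded_linear.linear\<close>)
  have scale: "\<forall>\<^sub>F t in at_right 0. P t (c *\<^sub>R f) = c *\<^sub>R P t f" for c f
    by (rule eventually_at_right_less[THEN eventually_mono])
      (use C0_bounded_linear[OF P] in \<open>simp add: linear_scale bounded_linear.linear\<close>)
  have zero: "\<forall>\<^sub>F t in at_right 0. P t 0 = 0"
    using scale[of 0 0] by simp
  show ?thesis
  proof (rule subspaceI)
    show "0 \<in> generator P"
      using zero unfolding generator_def zero_prod_def
      by (auto intro!: tendsto_eventually elim: eventually_mono)
  next
    fix x y assume "x \<in> generator P" "y \<in> generator P"
    then obtain f g f' g' where x: "x = (f, g)" "((\<lambda>t. (P t f - f) /\<^sub>R t) \<longlongrightarrow> g) (at_right 0)"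
      and y: "y = (f', g')" "((\<lambda>t. (P t f' - f') /\<^sub>R t) \<longlongrightarrow> g') (at_right 0)"
      by (auto simp: generator_def)
    have "((\<lambda>t. (P t (f + f') - (f + f')) /\<^sub>R t) \<longlongrightarrow> g + g') (at_right 0)"
      by (rule Lim_transform_eventually[OF tendsto_add[OF x(2) y(2)]])
        (rule eventually_mono[OF add[of f f']], simp add: algebra_simps)
    then show "x + y \<in> generator P" by (simp add: x y generator_def)
  next
    fix c :: real and x assume "x \<in> generator P"
    then obtain f g where x: "x = (f, g)" "((\<lambda>t. (P t f - f) /\<^sub>R t) \<longlongrightarrow> g) (at_right 0)"
      by (auto simp: generator_def)
    have "((\<lambda>t. (P t (c *\<^sub>R f) - c *\<^sub>R f) /\<^sub>R t) \<longlongrightarrow> c *\<^sub>R g) (at_right 0)"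
      by (rule Lim_transform_eventually[OF tendsto_scaleR[OF tendsto_const x(2)]])
        (rule eventually_mono[OF scale[of c f]], simp add: algebra_simps)
    then show "c *\<^sub>R x \<in> generator P" by (simp add: x generator_def)
  qed
qed

text \<open>From a point of the domain, the difference of the two orbits has \<open>T\<close> of
  itself as derivative, so dissipativity makes its norm nonincreasing, and it starts at 0. Density
  does the rest. This is what gives the description in \<open>exp_semigroup\<close> its
  value.\<close>

lemma semigroup_unique:
  fixes P Q :: "real \<Rightarrow> 'h::real_inner \<Rightarrow> 'h"
  assumes P: "generates_semigroup T P" and Q: "generates_semigroup T Q"
    and dense: "closure (Domain T) = UNIV" and t: "t \<ge> 0"
  shows "P t f = Q t f"
proof -
  have CP: "C0_contraction_semigroup P" and gP: "generator P = T"
    and CQ: "C0_contraction_semigroup Q" and gQ: "generator Q = T"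
    using P Q by (auto simp: generates_semigroup_def)
  have on_domain: "P t f = Q t f" if dom: "f \<in> Domain T" for f
  proof -
    obtain g where fg: "(f, g) \<in> T" using dom by (rule DomainE)
    let ?u = "\<lambda>t. P t f - Q t f"
    have "(norm (?u t))\<^sup>2 \<le> (norm (?u 0))\<^sup>2"
    proof (rule halfline_antimono[of "\<lambda>t. (norm (?u t))\<^sup>2" "\<lambda>t. 2 * (?u t \<bullet> (P t g - Q t g))"])
      fix t :: real assume t: "t \<ge> 0"
      have "(?u has_vector_derivative P t g - Q t g) (at t within {0..})"
        using semigroup_derivative[OF CP _ t, of f g] semigroup_derivative[OF CQ _ t, of f g] fg gP gQ
        by (intro has_vector_derivative_diff) auto
      then show "((\<lambda>t. (norm (?u t))\<^sup>2) has_real_derivative 2 * (?u t \<bullet> (P t g - Q t g)))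
          (at t within {0..})"
        by (rule norm_square_derivative)
      have "(?u t, P t g - Q t g) \<in> generator P"
        using subspace_diff[OF generator_subspace[OF CP], of "(P t f, P t g)" "(Q t f, Q t g)"]
          generator_invariant[OF CP _ t, of f g] generator_invariant[OF CQ _ t, of f g] fg gP gQ
        by auto
      then have "?u t \<bullet> (P t g - Q t g) \<le> 0" by (rule generator_dissipative[OF CP])
      then show "2 * (?u t \<bullet> (P t g - Q t g)) \<le> 0" by simp
    qed (use t in auto)
    then show ?thesis by (simp add: C0_zero[OF CP] C0_zero[OF CQ])
  qed
  have "closed {f. P t f = Q t f}"
    using C0_bounded_linear[OF CP t] C0_bounded_linear[OF CQ t]
    by (intro closed_Collect_eq linear_continuous_on)
  then have "closure (Domain T) \<subseteq> {f. P t f = Q t f}"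
    using on_domain by (intro closure_minimal) auto
  then show ?thesis using dense by auto
qed

lemma exp_semigroup_eq:
  fixes P :: "real \<Rightarrow> 'h::real_inner \<Rightarrow> 'h"
  assumes P: "generates_semigroup T P" and dense: "closure (Domain T) = UNIV" and t: "t \<ge> 0"
  shows "exp_semigroup T t f = P t f"
  unfolding exp_semigroup_def
proof (rule the_equality)
  show "\<exists>Q. generates_semigroup T Q \<and> P t f = Q t f"
    by (intro exI[of _ P] conjI P refl)
next
  fix g assume "\<exists>Q. generates_semigroup T Q \<and> g = Q t f"
  then obtain Q where Q: "generates_semigroup T Q" and g: "g = Q t f" by (elim exE conjE)
  show "g = P t f"
    unfolding g by (rule semigroup_unique[OF Q P dense t])
qed

section \<open>Yosida approximation\<close>

lemma norm_nonincreasing_halfline: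
  fixes w :: "real \<Rightarrow> 'h::real_inner"
  assumes deriv: "\<And>t. t \<ge> 0 \<Longrightarrow> (w has_vector_derivative w' t) (at t within {0..})"
    and le: "\<And>t. t \<ge> 0 \<Longrightarrow> w t \<bullet> w' t \<le> 0" and "0 \<le> t"
  shows "norm (w t) \<le> norm (w 0)"
proof -
  have "(norm (w t))\<^sup>2 \<le> (norm (w 0))\<^sup>2"
    by (rule halfline_antimono[of "\<lambda>t. (norm (w t))\<^sup>2" "\<lambda>t. 2 * (w t \<bullet> w' t)"])
      (use norm_square_derivative[OF deriv] le \<open>0 \<le> t\<close> in auto)
  then show ?thesis by (rule power2_le_imp_le) simp
qed

text \<open>Mean value inequality for \<open>u s - s *\<^sub>R y\<close>. With \<open>y\<close> the
  expected derivative at 0 it controls the difference quotient there.\<close>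

lemma halfline_linearization_bound:
  fixes u :: "real \<Rightarrow> 'h::real_normed_vector"
  assumes deriv: "\<And>s. (u has_vector_derivative u' s) (at s)"
    and bound: "\<And>s. 0 \<le> s \<Longrightarrow> s \<le> t \<Longrightarrow> norm (u' s - y) \<le> B" and "0 < t"
  shows "norm (u t - u 0 - t *\<^sub>R y) \<le> t * B"
proof -
  let ?v = "\<lambda>s. u s - s *\<^sub>R y"
  have v: "(?v has_vector_derivative u' s - y) (at s)" for s
    by (auto intro!: derivative_eq_intros deriv)
  have phi: "((\<lambda>s. B * s) has_vector_derivative B) (at s)" for s
    by (auto intro!: derivative_eq_intros simp flip: has_real_derivative_iff_has_vector_derivative)
  have "norm (?v t - ?v 0) \<le> B * t - B * 0"
    by (rule differentiable_bound_general[of 0 t ?v "\<lambda>s. B * s" "\<lambda>s. u' s - y" "\<lambda>s. B"])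
      (use v phi bound \<open>0 < t\<close> in \<open>auto intro!: continuous_intros continuous_at_imp_continuous_on
        intro: has_vector_derivative_continuous[OF deriv]\<close>)
  then show ?thesis by (simp add: algebra_simps)
qed

text \<open>The solution is the exponential series of t K applied to \<open>x\<close>. On each ball
  the terms and their derivatives are dominated by a convergent exponential series, so the sum may
  be differentiated termwise.\<close>

lemma bounded_linear_ode:
  fixes K :: "'h::banach \<Rightarrow> 'h"
  assumes "bounded_linear K"
  shows "\<exists>u. u 0 = x \<and> (\<forall>t::real. (u has_vector_derivative K (u t)) (at t))"
proof -
  interpret K: bounded_linear K by fact
  obtain M where M: "M \<ge> 0" "\<And>y. norm (K y) \<le> norm y * M"
    using K.nonneg_bounded by auto
  define f where "f n t = (t ^ n / fact n) *\<^sub>R (K ^^ n) x" for n and t :: real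
  \<comment> \<open>The derivative of the term of index n is \<open>K\<close> of the term of index n
    - 1, and the term of index 0 is constant. Because of this shift the series of derivatives sums
    to \<open>K (u t)\<close>.\<close>
  define f' where "f' n t = (case n of 0 \<Rightarrow> 0 | Suc m \<Rightarrow> K (f m t))" for n t
  define b where "b r n = norm x * ((r * M) ^ n / fact n)" for r n
  have pow: "norm ((K ^^ n) x) \<le> norm x * M ^ n" for n
  proof (induction n)
    case (Suc n)
    have "norm (K ((K ^^ n) x)) \<le> norm ((K ^^ n) x) * M" by (rule M)
    also have "\<dots> \<le> norm x * M ^ n * M" using Suc M(1) by (rule mult_right_mono)
    finally show ?case by (simp add: ac_simps)
  qed simp
  have f_le: "norm (f n t) \<le> b r n" if "\<bar>t\<bar> \<le> r" for n t r
  proof -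
    have "norm (f n t) \<le> (\<bar>t\<bar> ^ n / fact n) * (norm x * M ^ n)"
      unfolding f_def using pow[of n] by (simp add: power_abs mult_left_mono divide_right_mono)
    also have "\<dots> \<le> (r ^ n / fact n) * (norm x * M ^ n)"
      using that M(1) by (intro mult_right_mono divide_right_mono power_mono) auto
    also have "\<dots> = b r n" by (simp add: b_def power_mult_distrib)
    finally show ?thesis .
  qed
  have sum_b: "summable (b r)" for r
    unfolding b_def using summable_exp[of "r * M"]
    by (intro summable_mult) (simp add: divide_inverse mult.commute)
  have sum_f: "summable (\<lambda>n. f n t)" for t
    by (rule summable_comparison_test'[OF sum_b[of "\<bar>t\<bar>"], of 0]) (use f_le in auto)
  define u where "u t = (\<Sum>n. f n t)" for t
  have f_sums: "(\<lambda>n. f n t) sums u t" for t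
    unfolding u_def by (rule summable_sums[OF sum_f])
  have f'_sums: "(\<lambda>n. f' n t) sums K (u t)" for t
  proof -
    have "(\<lambda>n. f' (Suc n) t) sums K (u t)" 
      unfolding f'_def by (simp add: K.sums[OF f_sums])
    then show ?thesis by (subst (asm) sums_Suc_iff) (simp add: f'_def)
  qed
  have deriv_f: "(f n has_vector_derivative f' n t) (at t within X)" for n t X
  proof (cases n)
    case 0
    then show ?thesis by (simp add: f_def[abs_def] f'_def)
  next
    case (Suc m)
    have "((\<lambda>t. t ^ Suc m / fact (Suc m)) has_real_derivative
        real (Suc m) * t ^ (Suc m - Suc 0) / fact (Suc m)) (at t within X)"
      by (rule DERIV_cdivide[OF DERIV_pow])
    moreover have "real (Suc m) * t ^ (Suc m - Suc 0) / fact (Suc m) = t ^ m / fact m"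
      unfolding fact_Suc by (simp del: of_nat_Suc)
    ultimately have "((\<lambda>t. t ^ Suc m / fact (Suc m)) has_real_derivative t ^ m / fact m) (at t within X)"
      by (simp only:)
    then have "((\<lambda>t. (t ^ Suc m / fact (Suc m)) *\<^sub>R (K ^^ n) x) has_vector_derivative
        (t ^ m / fact m) *\<^sub>R (K ^^ n) x) (at t within X)"
      by (rule has_vector_derivative_scaleR[THEN has_vector_derivative_eq_rhs])
        (auto intro: derivative_eq_intros)
    then show ?thesis by (simp add: f_def[abs_def] f'_def Suc K.scaleR)
  qed
  have deriv: "(u has_vector_derivative K (u t)) (at t)" for t
  proof -
    define S where "S = ball (0::real) (\<bar>t\<bar> + 1)"
    have t: "t \<in> S" "open S" "convex S" by (auto simp: S_def)
    define c where "c n = (case n of 0 \<Rightarrow> 0 | Suc m \<Rightarrow> b (\<bar>t\<bar> + 1) m * M)" for n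
    have "summable c"
      unfolding c_def using summable_mult2[OF sum_b] by (subst summable_Suc_iff[symmetric]) simp
    have "uniform_limit S (\<lambda>n s. \<Sum>i<n. f' i s) (\<lambda>s. \<Sum>n. f' n s) sequentially"
    proof (rule Weierstrass_m_test[OF _ \<open>summable c\<close>])
      fix n s assume s: "s \<in> S"
      show "norm (f' n s) \<le> c n"
      proof (cases n)
        case (Suc m)
        have "norm (K (f m s)) \<le> norm (f m s) * M" by (rule M)
        also have "\<dots> \<le> b (\<bar>t\<bar> + 1) m * M"
          using f_le[of s "\<bar>t\<bar> + 1" m] s M(1) by (intro mult_right_mono) (auto simp: S_def)
        finally show ?thesis by (simp add: f'_def c_def Suc)
      qed (simp add: f'_def c_def)
    qed
    then have lim: "uniform_limit S (\<lambda>n s. \<Sum>i<n. f' i s) (\<lambda>s. K (u s)) sequentially"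
      by (simp add: sums_unique[OF f'_sums, symmetric])
    have "\<exists>g. \<forall>s\<in>S. (\<lambda>n. f n s) sums g s \<and> (g has_derivative (\<lambda>h. h *\<^sub>R K (u s))) (at s within S)"
    proof (rule has_derivative_series[OF t(3) _ _ t(1) f_sums])
      show "(f n has_derivative (\<lambda>h. h *\<^sub>R f' n s)) (at s within S)" for n s
        using deriv_f by (simp add: has_vector_derivative_def)
      show "\<forall>\<^sub>F n in sequentially. \<forall>s\<in>S. \<forall>h.
          norm ((\<Sum>i<n. h *\<^sub>R f' i s) - h *\<^sub>R K (u s)) \<le> e * norm h" if "e > 0" for e
        using uniform_limitD[OF lim that]
      proof (rule eventually_mono, intro ballI allI)
        fix n s h assume d: "\<forall>s\<in>S. dist (\<Sum>i<n. f' i s) (K (u s)) < e" and s: "s \<in> S"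
        have "(\<Sum>i<n. h *\<^sub>R f' i s) - h *\<^sub>R K (u s) = h *\<^sub>R ((\<Sum>i<n. f' i s) - K (u s))"
          by (simp add: scaleR_sum_right scaleR_diff_right)
        moreover have "norm ((\<Sum>i<n. f' i s) - K (u s)) \<le> e"
          using d s by (auto simp: dist_norm less_imp_le)
        ultimately show "norm ((\<Sum>i<n. h *\<^sub>R f' i s) - h *\<^sub>R K (u s)) \<le> e * norm h"
          by (simp add: mult.commute[of e] mult_left_mono)
      qed
    qed
    then obtain g where g: "\<And>s. s \<in> S \<Longrightarrow> (\<lambda>n. f n s) sums g s"
      "\<And>s. s \<in> S \<Longrightarrow> (g has_derivative (\<lambda>h. h *\<^sub>R K (u s))) (at s within S)" by auto
    have "g s = u s" if "s \<in> S" for s using sums_unique2[OF g(1)[OF that] f_sums] .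
    then have "(u has_derivative (\<lambda>h. h *\<^sub>R K (u t))) (at t within S)"
      by (intro has_derivative_transform[OF t(1) _ g(2)[OF t(1)]]) auto
    then show ?thesis
      unfolding has_vector_derivative_def at_within_open[OF t(1,2)] .
  qed
  have "u 0 = x"
  proof -
    have "f n 0 = (if n = 0 then x else 0)" for n by (simp add: f_def)
    then have "(\<lambda>n. f n 0) sums x" using sums_single[of 0 "\<lambda>_. x"] by simp
    then show ?thesis by (rule sums_unique2[OF f_sums])
  qed
  then show ?thesis using deriv by (intro exI[of _ u] conjI allI)
qed

section \<open>Resolvents and Yosida approximations of an m-accretive operator\<close>

locale m_accretive =
  fixes G :: "'h::{real_inner,banach} operator"
  assumes subspace: "subspace G"
    and accretive: "(f, g) \<in> G \<Longrightarrow> 0 \<le> f \<bullet> g"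
    and range: "c > 0 \<Longrightarrow> \<exists>f g. (f, g) \<in> G \<and> f + c *\<^sub>R g = h"
    and dense: "closure (Domain G) = UNIV"
begin

lemma G_add: "(f, g) \<in> G \<Longrightarrow> (f', g') \<in> G \<Longrightarrow> (f + f', g + g') \<in> G"
  and G_diff: "(f, g) \<in> G \<Longrightarrow> (f', g') \<in> G \<Longrightarrow> (f - f', g - g') \<in> G"
  and G_scale: "(f, g) \<in> G \<Longrightarrow> (a *\<^sub>R f, a *\<^sub>R g) \<in> G"
  using subspace_add[OF subspace, of "(f, g)" "(f', g')"] subspace_diff[OF subspace, of "(f, g)" "(f', g')"]
    subspace_scale[OF subspace, of "(f, g)" a] by auto

lemma range_unique:
  assumes "(f, g) \<in> G" "(f', g') \<in> G" "c > 0" "f + c *\<^sub>R g = f' + c *\<^sub>R g'"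
  shows "g = g'"
proof -
  have "f - f' = - (c *\<^sub>R (g - g'))" using assms(4) by (simp add: algebra_simps)
  then have "0 \<le> - (c * ((g - g') \<bullet> (g - g')))"
    using accretive[OF G_diff[OF assms(1,2)]] by simp
  then have "(g - g') \<bullet> (g - g') \<le> 0"
    using \<open>c > 0\<close> by (simp add: mult_le_0_iff)
  then show ?thesis by (metis inner_gt_zero_iff not_le right_minus_eq)
qed

text \<open>The Yosida approximation \<open>G (I + c G)\<^sup>-\<^sup>1\<close> of \<open>G\<close>.\<close>

definition yosida :: "real \<Rightarrow> 'h \<Rightarrow> 'h" where
  "yosida c h = (SOME g. (h - c *\<^sub>R g, g) \<in> G)"

lemma yosida_mem: assumes "c > 0" shows "(h - c *\<^sub>R yosida c h, yosida c h) \<in> G"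
proof -
  obtain f g where "(f, g) \<in> G" "f + c *\<^sub>R g = h" using range[OF assms] by blast
  then have "(h - c *\<^sub>R g, g) \<in> G" by auto
  then show ?thesis unfolding yosida_def by (rule someI)
qed

lemma yosida_eqI: assumes "c > 0" "(h - c *\<^sub>R g, g) \<in> G" shows "yosida c h = g"
  by (rule range_unique[OF yosida_mem[OF assms(1)] assms(2,1)]) simp

lemma yosida_norm_square_le: assumes "c > 0" shows "c * (norm (yosida c h))\<^sup>2 \<le> h \<bullet> yosida c h"
  using accretive[OF yosida_mem[OF assms, of h]] by (simp add: inner_diff_left power2_norm_eq_inner)

lemma yosida_bounded_linear: assumes "c > 0" shows "bounded_linear (yosida c)"
proof (rule bounded_linear_intro)
  show "yosida c (x + y) = yosida c x + yosida c y" for x y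
    by (rule yosida_eqI[OF assms])
      (use G_add[OF yosida_mem[OF assms] yosida_mem[OF assms], of x y] in \<open>simp add: algebra_simps\<close>)
  show "yosida c (a *\<^sub>R x) = a *\<^sub>R yosida c x" for a x
    by (rule yosida_eqI[OF assms])
      (use G_scale[OF yosida_mem[OF assms], of a x] in \<open>simp add: algebra_simps\<close>)
  show "norm (yosida c x) \<le> norm x * (1 / c)" for x
  proof (cases "yosida c x = 0")
    case False
    have "c * (norm (yosida c x))\<^sup>2 \<le> norm x * norm (yosida c x)"
      using yosida_norm_square_le[OF assms, of x] norm_cauchy_schwarz[of x "yosida c x"] by linarith
    then have "c * norm (yosida c x) \<le> norm x"
      using False by (simp add: power2_eq_square flip: mult.assoc)
    then show ?thesis using assms by (simp add: field_simps)
  qed (use assms in simp)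
qed

lemmas yosida_diff = bounded_linear.linear[OF yosida_bounded_linear, THEN linear_diff]

lemma yosida_accretive: "c > 0 \<Longrightarrow> 0 \<le> h \<bullet> yosida c h"
  using yosida_norm_square_le[of c h] by (smt (verit) mult_nonneg_nonneg zero_le_power2)

lemma yosida_norm_le: assumes "c > 0" "(h, g) \<in> G" shows "norm (yosida c h) \<le> norm g"
proof -
  let ?y = "yosida c h"
  have "(c *\<^sub>R ?y, g - ?y) \<in> G"
    using G_diff[OF assms(2) yosida_mem[OF assms(1), of h]] by simp
  then have "0 \<le> c * (?y \<bullet> (g - ?y))" using accretive by fastforce
  then have "?y \<bullet> ?y \<le> ?y \<bullet> g"
    using assms(1) by (simp add: zero_le_mult_iff inner_diff_right)
  also have "\<dots> \<le> norm ?y * norm g" by (rule norm_cauchy_schwarz)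
  finally have "norm ?y * norm ?y \<le> norm ?y * norm g"
    by (simp add: power2_norm_eq_inner[symmetric] power2_eq_square)
  then show ?thesis
    by (metis mult_le_cancel_left_pos norm_ge_zero order_le_less)
qed

text \<open>The right-hand side is the resolvent (I + c G)^-1 at \<open>g\<close>: the resolvent
  commutes with G. Convergence of the Yosida approximations is thereby reduced to convergence of the
  resolvents to the identity.\<close>

lemma yosida_eq_resolvent:
  assumes "c > 0" "(h, g) \<in> G"
  shows "yosida c h = g - c *\<^sub>R yosida c g"
proof (rule yosida_eqI[OF assms(1)])
  show "(h - c *\<^sub>R (g - c *\<^sub>R yosida c g), g - c *\<^sub>R yosida c g) \<in> G"
    using G_diff[OF assms(2) G_scale[OF yosida_mem[OF assms(1), of g], of c]] .
qed

lemma resolvent_norm_le: assumes "c > 0" shows "norm (h - c *\<^sub>R yosida c h) \<le> norm h"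
proof -
  have "(norm (h - c *\<^sub>R yosida c h))\<^sup>2 = (norm h)\<^sup>2 - 2 * c * (h \<bullet> yosida c h) + c\<^sup>2 * (norm (yosida c h))\<^sup>2"
    unfolding power2_norm_eq_inner
    by (simp add: inner_diff inner_commute power2_eq_square algebra_simps)
  moreover have "c * (c * (norm (yosida c h))\<^sup>2) \<le> c * (h \<bullet> yosida c h)"
    using yosida_norm_square_le[OF assms, of h] assms by (intro mult_left_mono) auto
  moreover have "0 \<le> c * (h \<bullet> yosida c h)"
    using yosida_accretive[OF assms, of h] assms by simp
  ultimately have "(norm (h - c *\<^sub>R yosida c h))\<^sup>2 \<le> (norm h)\<^sup>2"
    by (simp add: power2_eq_square)
  then show ?thesis by (rule power2_le_imp_le) simp
qed

lemma Domain_approx: assumes "e > 0" obtains f g where "(f, g) \<in> G" "dist f x < e"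
proof -
  obtain f where "f \<in> Domain G" "dist f x < e"
    using closure_approachable[of x "Domain G"] dense assms by blast
  then show ?thesis using that by (elim DomainE)
qed

text \<open>\<open>yosida c h\<close> is the resolvent at \<open>g\<close>, and \<open>g\<close> may
  lie outside the domain. Replacing it by \<open>g'\<close> in the domain costs twice the distance,
  resolvents being contractions, and at \<open>g'\<close> the error is at most
  \<open>c * norm k\<close>.\<close>

lemma yosida_tendsto:
  assumes "(h, g) \<in> G"
  shows "((\<lambda>c. yosida c h) \<longlongrightarrow> g) (at_right 0)"
proof (rule tendstoI)
  fix e :: real assume "e > 0"
  then have "e / 4 > 0" by simp
  then obtain g' k where g': "(g', k) \<in> G" "dist g' g < e / 4" by (rule Domain_approx)
  have lim: "((\<lambda>c. c * norm k) \<longlongrightarrow> 0) (at_right 0)"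
    by (auto intro!: tendsto_eq_intros)
  have "\<forall>\<^sub>F c in at_right 0. c * norm k < e / 2"
    by (rule order_tendstoD(2)[OF lim]) (use \<open>e > 0\<close> in simp)
  moreover have "\<forall>\<^sub>F c::real in at_right 0. 0 < c" by (rule eventually_at_right_less)
  ultimately show "\<forall>\<^sub>F c in at_right 0. dist (yosida c h) g < e"
  proof eventually_elim
    case (elim c)
    have "yosida c h - g = - (c *\<^sub>R yosida c g)"
      using yosida_eq_resolvent[OF elim(2) assms] by simp
    also have "\<dots> = (g - g' - c *\<^sub>R yosida c (g - g')) - (g - g') - c *\<^sub>R yosida c g'"
      by (simp add: yosida_diff[OF elim(2)] scaleR_diff_right)
    also have "norm \<dots> \<le> norm (g - g' - c *\<^sub>R yosida c (g - g')) + norm (g - g') + norm (c *\<^sub>R yosida c g')"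
      by (meson add_right_mono norm_triangle_ineq4 order_trans)
    also have "\<dots> \<le> norm (g - g') + norm (g - g') + c * norm k"
      using resolvent_norm_le[OF elim(2), of "g - g'"] yosida_norm_le[OF elim(2) g'(1)] elim(2)
      by (intro add_mono) (auto intro: mult_left_mono)
    finally show ?case using g'(2) elim(1) by (simp add: dist_norm norm_minus_commute)
  qed
qed

section \<open>Orbits of the Yosida approximations\<close>

definition flow :: "real \<Rightarrow> 'h \<Rightarrow> real \<Rightarrow> 'h" where
  "flow c x = (SOME u. u 0 = x \<and> (\<forall>t. (u has_vector_derivative - yosida c (u t)) (at t)))"

context
  fixes c :: real
  assumes c: "c > 0"
begin

lemma flow_zero: "flow c x 0 = x"
  and flow_derivative: "(flow c x has_vector_derivative - yosida c (flow c x t)) (at t)"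
proof -
  have "\<exists>u. u 0 = x \<and> (\<forall>t. (u has_vector_derivative - yosida c (u t)) (at t))"
    by (rule bounded_linear_ode) (rule bounded_linear_minus[OF yosida_bounded_linear[OF c]])
  then have *: "flow c x 0 = x \<and> (\<forall>t. (flow c x has_vector_derivative - yosida c (flow c x t)) (at t))"
    unfolding flow_def by (rule someI_ex)
  show "flow c x 0 = x" by (rule conjunct1[OF *])
  show "(flow c x has_vector_derivative - yosida c (flow c x t)) (at t)"
    by (rule spec[OF conjunct2[OF *]])
qed

lemma flow_contraction_ode:
  assumes "\<And>t. (u has_vector_derivative - yosida c (u t)) (at t)"
    and "\<And>t. (v has_vector_derivative - yosida c (v t)) (at t)" and "0 \<le> t"
  shows "norm (u t - v t) \<le> norm (u 0 - v 0)"
proof (rule norm_nonincreasing_halfline[of "\<lambda>t. u t - v t"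
      "\<lambda>t. - yosida c (u t) - - yosida c (v t)", OF _ _ \<open>0 \<le> t\<close>])
  fix t
  show "((\<lambda>t. u t - v t) has_vector_derivative - yosida c (u t) - - yosida c (v t)) (at t within {0..})"
    by (rule has_vector_derivative_diff[OF assms(1,2)[THEN has_vector_derivative_at_within]])
  have "- yosida c (u t) - - yosida c (v t) = - yosida c (u t - v t)"
    by (simp add: yosida_diff[OF c])
  then show "(u t - v t) \<bullet> (- yosida c (u t) - - yosida c (v t)) \<le> 0"
    using yosida_accretive[OF c, of "u t - v t"] by simp
qed

lemma flow_contraction: "0 \<le> t \<Longrightarrow> norm (flow c x t - flow c y t) \<le> norm (x - y)"
  using flow_contraction_ode[of "flow c x" "flow c y" t] flow_derivative by (simp add: flow_zero)

lemma flow_eqI: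
  assumes "\<And>t. (u has_vector_derivative - yosida c (u t)) (at t)" "u 0 = x" "0 \<le> t"
  shows "u t = flow c x t"
  using flow_contraction_ode[of u "flow c x" t, OF assms(1) flow_derivative assms(3)] assms(2)
  by (simp add: flow_zero)

lemma flow_linear:
  assumes "0 \<le> t"
  shows "linear (\<lambda>x. flow c x t)"
proof (rule linearI)
  interpret bounded_linear "yosida c" by (rule yosida_bounded_linear[OF c])
  show "flow c (x + y) t = flow c x t + flow c y t" for x y
    by (rule flow_eqI[of "\<lambda>t. flow c x t + flow c y t", symmetric, OF _ _ assms])
      (auto intro!: derivative_eq_intros flow_derivative simp: add flow_zero)
  show "flow c (a *\<^sub>R x) t = a *\<^sub>R flow c x t" for a x
    by (rule flow_eqI[of "\<lambda>t. a *\<^sub>R flow c x t", symmetric, OF _ _ assms])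
      (auto intro!: derivative_eq_intros flow_derivative simp: scaleR flow_zero)
qed

lemma flow_add:
  assumes "0 \<le> t"
  shows "flow c x (s + t) = flow c (flow c x s) t"
proof (rule flow_eqI[of "\<lambda>t. flow c x (s + t)", OF _ _ assms])
  fix t
  have "((flow c x \<circ> (\<lambda>t. s + t)) has_vector_derivative 1 *\<^sub>R - yosida c (flow c x (s + t))) (at t)"
    by (rule vector_diff_chain_at) (auto intro!: derivative_eq_intros flow_derivative)
  then show "((\<lambda>t. flow c x (s + t)) has_vector_derivative - yosida c (flow c x (s + t))) (at t)"
    by (simp add: o_def)
qed simp

text \<open>Both sides solve the same equation with the same initial value. The commutation bounds
  the speed of an orbit by its initial speed, hence uniformly in \<open>c\<close> for starting
  points in the domain.\<close>

lemma yosida_flow: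
  assumes "0 \<le> t"
  shows "yosida c (flow c x t) = flow c (yosida c x) t"
proof (rule flow_eqI[of "\<lambda>t. yosida c (flow c x t)", OF _ _ assms])
  interpret bounded_linear "yosida c" by (rule yosida_bounded_linear[OF c])
  show "((\<lambda>t. yosida c (flow c x t)) has_vector_derivative - yosida c (yosida c (flow c x t))) (at t)" for t
    using has_vector_derivative[OF flow_derivative] by (simp add: neg)
qed (simp add: flow_zero)

lemma flow_norm_le: "0 \<le> t \<Longrightarrow> norm (flow c x t) \<le> norm x"
  using flow_contraction[of t x 0] linear_0[OF flow_linear, of t] by simp

lemma yosida_flow_norm_le:
  assumes "0 \<le> t" "(x, g) \<in> G"
  shows "norm (yosida c (flow c x t)) \<le> norm g"
  using flow_norm_le[OF assms(1), of "yosida c x"] yosida_norm_le[OF c assms(2)]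
  by (simp add: yosida_flow[OF assms(1)])

lemma flow_diff_initial_le:
  assumes "0 \<le> t" "(x, g) \<in> G"
  shows "norm (flow c x t - x) \<le> t * norm g"
proof (cases "t = 0")
  case False
  have "norm (flow c x t - flow c x 0 - t *\<^sub>R 0) \<le> t * norm g"
    by (rule halfline_linearization_bound[of "flow c x", OF flow_derivative])
      (use False assms yosida_flow_norm_le in auto)
  then show ?thesis by (simp add: flow_zero)
qed (simp add: flow_zero)

text \<open>Meant for differentiating the limit semigroup at 0. The speed along the orbit is
  compared with \<open>g\<close> through a point \<open>y\<close> of the domain: \<open>g\<close>
  may lie outside it, and the uniform bound \<open>t * norm k\<close> on the displacement of an
  orbit is available only for domain points.\<close>

lemma flow_linearization:
  assumes "0 < t" "(x, g) \<in> G" "(y, k) \<in> G"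
  shows "norm (flow c x t - x + t *\<^sub>R g) \<le> t * (norm (yosida c x - y) + norm (y - g) + t * norm k)"
proof -
  have "norm (flow c x t - flow c x 0 - t *\<^sub>R (- g)) \<le> t * (norm (yosida c x - y) + norm (y - g) + t * norm k)"
  proof (rule halfline_linearization_bound[of "flow c x", OF flow_derivative _ assms(1)])
    fix s assume s: "0 \<le> s" "s \<le> t"
    have "- yosida c (flow c x s) - - g
        = - ((flow c (yosida c x) s - flow c y s) + (flow c y s - y) + (y - g))"
      by (simp add: yosida_flow[OF s(1)])
    also have "norm \<dots> \<le> norm (flow c (yosida c x) s - flow c y s) + norm (flow c y s - y) + norm (y - g)"
      by (metis norm_minus_cancel norm_triangle_mono order_refl norm_triangle_ineq)
    also have "\<dots> \<le> norm (yosida c x - y) + t * norm k + norm (y - g)"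
      using flow_contraction[OF s(1), of "yosida c x" y] flow_diff_initial_le[OF s(1) assms(3)]
        mult_right_mono[OF s(2), of "norm k"] by simp
    finally show "norm (- yosida c (flow c x s) - - g) \<le> norm (yosida c x - y) + norm (y - g) + t * norm k"
      by simp
  qed
  then show ?thesis by (simp add: flow_zero)
qed

end

text \<open>In \<open>w = (J\<^sub>c u - J\<^sub>d v) + (c G\<^sub>c u - d G\<^sub>d v)\<close>, with \<open>J\<close> the resolvents and \<open>G\<^sub>c\<close>, \<open>G\<^sub>d\<close> the Yosida
  approximations, the first term pairs with \<open>G\<^sub>c u - G\<^sub>d v\<close> nonnegatively by accretivity of \<open>G\<close>.\<close>

lemma flow_diff_le:
  assumes c: "c > 0" and d: "d > 0" and t: "0 \<le> t" and xg: "(x, g) \<in> G"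
  shows "(norm (flow c x t - flow d x t))\<^sup>2 \<le> 4 * t * (c + d) * (norm g)\<^sup>2"
proof -
  let ?w = "\<lambda>t. flow c x t - flow d x t"
  let ?w' = "\<lambda>t. yosida d (flow d x t) - yosida c (flow c x t)"
  let ?h = "\<lambda>t. (norm (?w t))\<^sup>2 - 4 * (c + d) * (norm g)\<^sup>2 * t"
  have "?h t \<le> ?h 0"
  proof (rule halfline_antimono[of ?h "\<lambda>t. 2 * (?w t \<bullet> ?w' t) - 4 * (c + d) * (norm g)\<^sup>2"])
    fix t :: real assume t: "t \<ge> 0"
    have "(?w has_vector_derivative - yosida c (flow c x t) - - yosida d (flow d x t)) (at t within {0..})"
      by (intro has_vector_derivative_diff flow_derivative[THEN has_vector_derivative_at_within] c d)
    then have "(?w has_vector_derivative ?w' t) (at t within {0..})" by simp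
    note deriv = norm_square_derivative[OF this]
    show "(?h has_real_derivative 2 * (?w t \<bullet> ?w' t) - 4 * (c + d) * (norm g)\<^sup>2) (at t within {0..})"
      by (rule DERIV_diff[OF deriv]) (auto intro!: derivative_eq_intros)
    define a b where "a = yosida c (flow c x t)" and "b = yosida d (flow d x t)"
    have ab: "norm a \<le> norm g" "norm b \<le> norm g"
      unfolding a_def b_def by (intro yosida_flow_norm_le c d t xg)+
    have "(flow c x t - c *\<^sub>R a - (flow d x t - d *\<^sub>R b), a - b) \<in> G"
      unfolding a_def b_def by (intro G_diff yosida_mem c d)
    then have acc: "0 \<le> (flow c x t - c *\<^sub>R a - (flow d x t - d *\<^sub>R b)) \<bullet> (a - b)" by (rule accretive)
    have w: "?w t = (flow c x t - c *\<^sub>R a - (flow d x t - d *\<^sub>R b)) + (c *\<^sub>R a - d *\<^sub>R b)" by simp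
    have "?w t \<bullet> (b - a) = - ((flow c x t - c *\<^sub>R a - (flow d x t - d *\<^sub>R b)) \<bullet> (a - b))
        + (c *\<^sub>R a - d *\<^sub>R b) \<bullet> (b - a)"
      by (subst w) (simp add: inner_simps)
    also have "\<dots> \<le> (c *\<^sub>R a - d *\<^sub>R b) \<bullet> (b - a)" using acc by linarith
    also have "\<dots> \<le> norm (c *\<^sub>R a - d *\<^sub>R b) * norm (b - a)" by (rule norm_cauchy_schwarz)
    also have "\<dots> \<le> ((c + d) * norm g) * (2 * norm g)"
    proof (rule mult_mono)
      have "norm (c *\<^sub>R a - d *\<^sub>R b) \<le> c * norm a + d * norm b"
        using norm_triangle_ineq4[of "c *\<^sub>R a" "d *\<^sub>R b"] c d by simp
      also have "\<dots> \<le> c * norm g + d * norm g"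
        using ab c d by (intro add_mono mult_left_mono) auto
      finally show "norm (c *\<^sub>R a - d *\<^sub>R b) \<le> (c + d) * norm g" by (simp add: algebra_simps)
      show "norm (b - a) \<le> 2 * norm g"
        using norm_triangle_ineq4[of b a] ab by linarith
    qed (use c d in auto)
    finally show "2 * (?w t \<bullet> ?w' t) - 4 * (c + d) * (norm g)\<^sup>2 \<le> 0"
      by (simp add: a_def b_def power2_eq_square algebra_simps)
  qed (use t in auto)
  then show ?thesis by (simp add: flow_zero c d ac_simps)
qed

section \<open>The limit semigroup and its generator\<close>

abbreviation \<epsilon> :: "nat \<Rightarrow> real" where "\<epsilon> n \<equiv> inverse (real (Suc n))"

lemma eps_pos: "\<epsilon> n > 0" by simp

text \<open>Two flows are compared by \<open>flow_diff_le\<close> only from points of the domain,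
  where their distance tends to 0 with the parameters. Arbitrary \<open>x\<close> are reached by
  density, since all flows are contractions.\<close>

lemma flow_Cauchy:
  assumes t: "0 \<le> t"
  shows "Cauchy (\<lambda>n. flow (\<epsilon> n) x t)"
proof (rule metric_CauchyI)
  fix e :: real assume "e > 0"
  then have "e / 3 > 0" by simp
  then obtain y k where y: "(y, k) \<in> G" "dist y x < e / 3" by (rule Domain_approx)
  have lim: "(\<lambda>n. 4 * t * (\<epsilon> n + \<epsilon> n) * (norm k)\<^sup>2) \<longlonglongrightarrow> 0"
    by (rule tendsto_eq_intros LIMSEQ_inverse_real_of_nat refl | simp)+
  have "\<forall>\<^sub>F n in sequentially. 4 * t * (\<epsilon> n + \<epsilon> n) * (norm k)\<^sup>2 < (e / 3)\<^sup>2"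
    by (rule order_tendstoD(2)[OF lim]) (use \<open>e > 0\<close> in simp)
  then obtain M where M: "4 * t * (\<epsilon> M + \<epsilon> M) * (norm k)\<^sup>2 < (e / 3)\<^sup>2"
    by (auto simp: eventually_sequentially)
  have "dist (flow (\<epsilon> m) x t) (flow (\<epsilon> n) x t) < e" if "M \<le> m" "M \<le> n" for m n
  proof -
    have "(norm (flow (\<epsilon> m) y t - flow (\<epsilon> n) y t))\<^sup>2 \<le> 4 * t * (\<epsilon> m + \<epsilon> n) * (norm k)\<^sup>2"
      by (rule flow_diff_le[OF eps_pos eps_pos t y(1)])
    also have "\<dots> \<le> 4 * t * (\<epsilon> M + \<epsilon> M) * (norm k)\<^sup>2"
      using that t by (intro mult_right_mono mult_left_mono add_mono le_imp_inverse_le) auto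
    also note M
    finally have 1: "norm (flow (\<epsilon> m) y t - flow (\<epsilon> n) y t) < e / 3"
      by (rule power2_less_imp_less) (use \<open>e > 0\<close> in simp)
    have 2: "norm (flow (\<epsilon> m) x t - flow (\<epsilon> m) y t) < e / 3"
      using flow_contraction[OF eps_pos t, of m x y] y(2) by (simp add: dist_norm norm_minus_commute)
    have 3: "norm (flow (\<epsilon> n) y t - flow (\<epsilon> n) x t) < e / 3"
      using flow_contraction[OF eps_pos t, of n y x] y(2) by (simp add: dist_norm)
    have "dist (flow (\<epsilon> m) x t) (flow (\<epsilon> n) x t)
        = norm ((flow (\<epsilon> m) x t - flow (\<epsilon> m) y t) + (flow (\<epsilon> m) y t - flow (\<epsilon> n) y t)
            + (flow (\<epsilon> n) y t - flow (\<epsilon> n) x t))"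
      by (simp add: dist_norm)
    also have "\<dots> < e / 3 + e / 3 + e / 3"
      by (intro norm_add_less 1 2 3)
    finally show ?thesis by simp
  qed
  then show "\<exists>M. \<forall>m\<ge>M. \<forall>n\<ge>M. dist (flow (\<epsilon> m) x t) (flow (\<epsilon> n) x t) < e" by blast
qed

definition semigroup :: "real \<Rightarrow> 'h \<Rightarrow> 'h" where
  "semigroup t x = lim (\<lambda>n. flow (\<epsilon> n) x t)"

lemma flow_tendsto: "0 \<le> t \<Longrightarrow> (\<lambda>n. flow (\<epsilon> n) x t) \<longlonglongrightarrow> semigroup t x"
  unfolding semigroup_def using Cauchy_convergent[OF flow_Cauchy] by (simp add: convergent_LIMSEQ_iff)

lemma semigroup_norm_le: "0 \<le> t \<Longrightarrow> norm (semigroup t x) \<le> norm x"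
  by (rule LIMSEQ_le_const2[OF tendsto_norm[OF flow_tendsto]]) (use flow_norm_le[OF eps_pos] in auto)

lemma semigroup_bounded_linear:
  assumes "0 \<le> t"
  shows "bounded_linear (semigroup t)"
proof (rule bounded_linear_intro)
  note lin = flow_linear[OF eps_pos assms]
  show "semigroup t (x + y) = semigroup t x + semigroup t y" for x y
    using tendsto_add[OF flow_tendsto flow_tendsto, OF assms assms, of x y]
    by (intro LIMSEQ_unique[OF flow_tendsto[OF assms]]) (simp add: linear_add[OF lin] del: of_nat_Suc)
  show "semigroup t (a *\<^sub>R x) = a *\<^sub>R semigroup t x" for a x
    using tendsto_scaleR[OF tendsto_const flow_tendsto, OF assms, of a x]
    by (intro LIMSEQ_unique[OF flow_tendsto[OF assms]]) (simp add: linear_scale[OF lin] del: of_nat_Suc)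
  show "norm (semigroup t x) \<le> norm x * 1" for x
    using semigroup_norm_le[OF assms] by simp
qed

lemma semigroup_add:
  assumes "0 \<le> s" "0 \<le> t"
  shows "semigroup (s + t) x = semigroup s (semigroup t x)"
proof (rule LIMSEQ_unique)
  show "(\<lambda>n. flow (\<epsilon> n) x (s + t)) \<longlonglongrightarrow> semigroup (s + t) x"
    using assms by (intro flow_tendsto) simp
  \<comment> \<open>The starting point of the outer flow varies with \<open>n\<close>; contractivity
    allows it to be replaced by its limit.\<close>
  have "(\<lambda>n. norm (flow (\<epsilon> n) x t - semigroup t x)) \<longlonglongrightarrow> 0"
    using flow_tendsto[OF assms(2), of x] by (intro tendsto_norm_zero) (simp add: LIM_zero)
  then have "(\<lambda>n. flow (\<epsilon> n) (flow (\<epsilon> n) x t) s - flow (\<epsilon> n) (semigroup t x) s) \<longlonglongrightarrow> 0"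
    by (rule Lim_null_comparison[rotated]) (use flow_contraction[OF eps_pos assms(1)] in simp)
  then have "(\<lambda>n. flow (\<epsilon> n) (flow (\<epsilon> n) x t) s - flow (\<epsilon> n) (semigroup t x) s
      + flow (\<epsilon> n) (semigroup t x) s) \<longlonglongrightarrow> 0 + semigroup s (semigroup t x)"
    by (rule tendsto_add[OF _ flow_tendsto[OF assms(1)]])
  then show "(\<lambda>n. flow (\<epsilon> n) x (s + t)) \<longlonglongrightarrow> semigroup s (semigroup t x)"
    by (simp add: flow_add[OF eps_pos assms(1), of _ x t, symmetric] add.commute del: of_nat_Suc)
qed

lemma semigroup_diff_initial_le:
  assumes "0 \<le> t" "(x, g) \<in> G"
  shows "norm (semigroup t x - x) \<le> t * norm g"
  by (rule LIMSEQ_le_const2[OF tendsto_norm[OF tendsto_diff[OF flow_tendsto[OF assms(1)] tendsto_const]]])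
    (use flow_diff_initial_le[OF eps_pos assms] in auto)

lemma semigroup_tendsto: "((\<lambda>t. semigroup t x) \<longlongrightarrow> x) (at_right 0)"
proof (rule tendstoI)
  fix e :: real assume "e > 0"
  then have "e / 3 > 0" by simp
  then obtain y k where y: "(y, k) \<in> G" "dist y x < e / 3" by (rule Domain_approx)
  have lim: "((\<lambda>t. t * norm k) \<longlongrightarrow> 0) (at_right 0)"
    by (auto intro!: tendsto_eq_intros)
  have "\<forall>\<^sub>F t in at_right 0. t * norm k < e / 3"
    by (rule order_tendstoD(2)[OF lim]) (use \<open>e > 0\<close> in simp)
  moreover have "\<forall>\<^sub>F t::real in at_right 0. 0 < t" by (rule eventually_at_right_less)
  ultimately show "\<forall>\<^sub>F t in at_right 0. dist (semigroup t x) x < e"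
  proof eventually_elim
    case (elim t)
    then have t: "0 \<le> t" by simp
    interpret bounded_linear "semigroup t" by (rule semigroup_bounded_linear[OF t])
    have 1: "norm (semigroup t x - semigroup t y) < e / 3"
      using semigroup_norm_le[OF t, of "x - y"] y(2) by (simp add: diff dist_norm norm_minus_commute)
    have 2: "norm (semigroup t y - y) < e / 3"
      using semigroup_diff_initial_le[OF t y(1)] elim(1) by simp
    have 3: "norm (y - x) < e / 3" using y(2) by (simp add: dist_norm)
    have "dist (semigroup t x) x = norm ((semigroup t x - semigroup t y) + (semigroup t y - y) + (y - x))"
      by (simp add: dist_norm)
    also have "\<dots> < e / 3 + e / 3 + e / 3"
      by (intro norm_add_less 1 2 3)
    finally show ?case by simp
  qed
qed

lemma C0_contraction_semigroup: "C0_contraction_semigroup semigroup"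
proof -
  have "semigroup 0 x = x" for x
    by (rule LIMSEQ_unique[OF flow_tendsto]) (simp_all add: flow_zero[OF eps_pos] del: of_nat_Suc)
  then show ?thesis
    unfolding C0_contraction_semigroup_def
    by (intro conjI allI impI semigroup_bounded_linear semigroup_norm_le semigroup_add semigroup_tendsto)
qed

lemma semigroup_linearization:
  assumes t: "0 < t" and xg: "(x, g) \<in> G" and yk: "(y, k) \<in> G"
  shows "norm (semigroup t x - x + t *\<^sub>R g) \<le> t * (norm (g - y) + norm (y - g) + t * norm k)"
proof (rule LIMSEQ_le)
  show "(\<lambda>n. norm (flow (\<epsilon> n) x t - x + t *\<^sub>R g)) \<longlonglongrightarrow> norm (semigroup t x - x + t *\<^sub>R g)"
    using t by (intro tendsto_intros flow_tendsto) simp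
  have "filterlim \<epsilon> (at_right 0) sequentially"
    using LIMSEQ_inverse_real_of_nat by (simp add: filterlim_at)
  from filterlim_compose[OF yosida_tendsto[OF xg] this]
  show "(\<lambda>n. t * (norm (yosida (\<epsilon> n) x - y) + norm (y - g) + t * norm k))
      \<longlonglongrightarrow> t * (norm (g - y) + norm (y - g) + t * norm k)"
    by (intro tendsto_intros)
  show "\<exists>M. \<forall>n\<ge>M. norm (flow (\<epsilon> n) x t - x + t *\<^sub>R g)
      \<le> t * (norm (yosida (\<epsilon> n) x - y) + norm (y - g) + t * norm k)"
    using flow_linearization[OF eps_pos t xg yk] by blast
qed

lemma neg_mem_generator:
  assumes xg: "(x, g) \<in> G"
  shows "(x, - g) \<in> generator semigroup"
proof -
  have "((\<lambda>t. (semigroup t x - x) /\<^sub>R t) \<longlongrightarrow> - g) (at_right 0)"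
  proof (rule tendstoI)
    fix e :: real assume "e > 0"
    then have "e / 4 > 0" by simp
    then obtain y k where y: "(y, k) \<in> G" "dist y g < e / 4" by (rule Domain_approx)
    have lim: "((\<lambda>t. t * norm k) \<longlongrightarrow> 0) (at_right 0)"
      by (auto intro!: tendsto_eq_intros)
    have "\<forall>\<^sub>F t in at_right 0. t * norm k < e / 2"
      by (rule order_tendstoD(2)[OF lim]) (use \<open>e > 0\<close> in simp)
    moreover have "\<forall>\<^sub>F t::real in at_right 0. 0 < t" by (rule eventually_at_right_less)
    ultimately show "\<forall>\<^sub>F t in at_right 0. dist ((semigroup t x - x) /\<^sub>R t) (- g) < e"
    proof eventually_elim
      case (elim t)
      have "(semigroup t x - x) /\<^sub>R t - (- g) = (semigroup t x - x + t *\<^sub>R g) /\<^sub>R t"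
        using elim(2) by (simp add: scaleR_add_right)
      then have "dist ((semigroup t x - x) /\<^sub>R t) (- g) = norm (semigroup t x - x + t *\<^sub>R g) / t"
        using elim(2) by (simp add: dist_norm divide_inverse mult.commute)
      also have "\<dots> \<le> norm (g - y) + norm (y - g) + t * norm k"
        using semigroup_linearization[OF elim(2) xg y(1)] elim(2)
        by (simp add: divide_le_eq mult.commute)
      also have "\<dots> < e"
        using y(2) elim(1) by (simp add: dist_norm norm_minus_commute)
      finally show ?case .
    qed
  qed
  then show ?thesis by (simp add: generator_def)
qed

text \<open>Equality is a maximality argument. For \<open>(f, g)\<close> in the generator,
  surjectivity of I + G supplies \<open>(p, q)\<close> in \<open>G\<close> such that the generator
  maps f - p to f - p itself, and dissipativity then forces f = p.\<close>

theorem generates_semigroup: "generates_semigroup (neg_op G) semigroup"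
proof -
  note C0 = C0_contraction_semigroup
  have "generator semigroup \<subseteq> neg_op G"
  proof (rule subrelI)
    fix f g assume fg: "(f, g) \<in> generator semigroup"
    obtain p q where pq: "(p, q) \<in> G" "p + 1 *\<^sub>R q = f - g" 
      using range[OF zero_less_one, of "f - g"] by (elim exE conjE)
    have "(f - p, g + q) \<in> generator semigroup"
      using subspace_diff[OF generator_subspace[OF C0] fg neg_mem_generator[OF pq(1)]] by simp
    then have "(f - p) \<bullet> (g + q) \<le> 0" by (rule generator_dissipative[OF C0])
    moreover have *: "g + q = f - p" using pq(2) by (simp add: algebra_simps)
    ultimately have "f - p = 0" by (metis inner_gt_zero_iff not_le)
    then have "f = p" "g = - q" using * by (auto simp: eq_neg_iff_add_eq_0)
    then show "(f, g) \<in> neg_op G" using pq(1) by (auto simp: neg_op_def)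
  qed
  moreover have "neg_op G \<subseteq> generator semigroup"
    using neg_mem_generator by (auto simp: neg_op_def)
  ultimately show ?thesis using C0 by (simp add: generates_semigroup_def)
qed

end

section \<open>The operator \<open>T\<^sup>* T\<close>\<close>

text \<open>A minimising sequence is Cauchy by the parallelogram law, and at its limit the first
  variation vanishes.\<close>

lemma closed_subspace_projection:
  fixes x :: "'a::{real_inner,banach}"
  assumes S: "subspace S" "closed S"
  obtains p where "p \<in> S" "\<And>y. y \<in> S \<Longrightarrow> (x - p) \<bullet> y = 0"
proof -
  define d where "d = (INF y\<in>S. (norm (x - y))\<^sup>2)"
  have ne: "S \<noteq> {}" using subspace_0[OF S(1)] by auto
  have bdd: "bdd_below ((\<lambda>y. (norm (x - y))\<^sup>2) ` S)" by (rule bdd_belowI[of _ 0]) auto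
  have d_le: "d \<le> (norm (x - y))\<^sup>2" if "y \<in> S" for y
    unfolding d_def by (rule cINF_lower[OF bdd that])
  have "\<exists>y\<in>S. (norm (x - y))\<^sup>2 < d + inverse (real (Suc n))" for n
    using cINF_less_iff[OF ne bdd, of "d + inverse (real (Suc n))"] by (simp add: d_def)
  then obtain y where y: "\<And>n. y n \<in> S" "\<And>n. (norm (x - y n))\<^sup>2 < d + inverse (real (Suc n))"
    by metis
  have "Cauchy y"
  proof (rule metric_CauchyI)
    fix e :: real assume "e > 0"
    have lim: "(\<lambda>n. 4 * inverse (real (Suc n))) \<longlonglongrightarrow> 0"
      by (rule tendsto_eq_intros LIMSEQ_inverse_real_of_nat refl | simp)+
    have "\<forall>\<^sub>F n in sequentially. 4 * inverse (real (Suc n)) < e\<^sup>2"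
      by (rule order_tendstoD(2)[OF lim]) (use \<open>e > 0\<close> in simp)
    then obtain M where M: "4 * inverse (real (Suc M)) < e\<^sup>2"
      by (auto simp: eventually_sequentially)
    have "dist (y m) (y n) < e" if "M \<le> m" "M \<le> n" for m n
    proof -
      let ?z = "(1/2) *\<^sub>R (y m + y n)"
      have "?z \<in> S" by (intro subspace_scale subspace_add S y)
      then have "d \<le> (norm (x - ?z))\<^sup>2" by (rule d_le)
      moreover have "(norm (y m - y n))\<^sup>2
          = 2 * (norm (x - y m))\<^sup>2 + 2 * (norm (x - y n))\<^sup>2 - 4 * (norm (x - ?z))\<^sup>2"
        unfolding power2_norm_eq_inner by (simp add: inner_simps inner_commute algebra_simps)
      moreover have "inverse (real (Suc m)) \<le> inverse (real (Suc M))"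
        "inverse (real (Suc n)) \<le> inverse (real (Suc M))"
        using that by (intro le_imp_inverse_le; simp)+
      ultimately have "(norm (y m - y n))\<^sup>2 < e\<^sup>2"
        using y(2)[of m] y(2)[of n] M by linarith
      then show ?thesis
        unfolding dist_norm by (rule power2_less_imp_less) (use \<open>e > 0\<close> in simp)
    qed
    then show "\<exists>M. \<forall>m\<ge>M. \<forall>n\<ge>M. dist (y m) (y n) < e" by blast
  qed
  then obtain p where p: "y \<longlonglongrightarrow> p" using Cauchy_convergent by (auto simp: convergent_def)
  have "p \<in> S" by (rule closed_sequentially[OF S(2) y(1) p])
  have "(norm (x - p))\<^sup>2 \<le> d + 0"
  proof (rule LIMSEQ_le)
    show "(\<lambda>n. (norm (x - y n))\<^sup>2) \<longlonglongrightarrow> (norm (x - p))\<^sup>2" by (intro tendsto_intros p)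
    show "(\<lambda>n. d + inverse (real (Suc n))) \<longlonglongrightarrow> d + 0"
      by (intro tendsto_intros LIMSEQ_inverse_real_of_nat)
    show "\<exists>N. \<forall>n\<ge>N. (norm (x - y n))\<^sup>2 \<le> d + inverse (real (Suc n))"
      using y(2) by (auto intro!: less_imp_le simp del: of_nat_Suc)
  qed
  then have min: "(norm (x - p))\<^sup>2 \<le> (norm (x - (p + t *\<^sub>R z)))\<^sup>2" if "z \<in> S" for t z
    using d_le[of "p + t *\<^sub>R z"] subspace_add[OF S(1) \<open>p \<in> S\<close> subspace_scale[OF S(1) that]]
    by (smt (verit, best))
  have "(x - p) \<bullet> z = 0" if "z \<in> S" for z
  proof (cases "z = 0")
    case False
    let ?a = "(x - p) \<bullet> z" and ?b = "z \<bullet> z"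
    have b: "?b > 0" using False by simp
    have expand: "(norm (w - c *\<^sub>R z))\<^sup>2 = (norm w)\<^sup>2 - 2 * c * (w \<bullet> z) + c\<^sup>2 * ?b" for w c
      unfolding power2_norm_eq_inner by (simp add: inner_simps inner_commute algebra_simps power2_eq_square)
    \<comment> \<open>\<open>?a / ?b\<close> is the step along \<open>z\<close> that minimises the
      squared distance; it lowers it by \<open>?a\<^sup>2 / ?b\<close>, which the minimality of
      \<open>p\<close> permits only if \<open>?a = 0\<close>.\<close>
    have "(norm (x - (p + (?a / ?b) *\<^sub>R z)))\<^sup>2 = (norm (x - p))\<^sup>2 - 2 * (?a / ?b) * ?a + (?a / ?b)\<^sup>2 * ?b"
      using expand[of "x - p" "?a / ?b"] by (simp add: diff_diff_eq)
    also have "\<dots> = (norm (x - p))\<^sup>2 - ?a\<^sup>2 / ?b"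
      using b by (simp add: power2_eq_square)
    finally have "?a\<^sup>2 / ?b \<le> 0" using min[OF that, of "?a / ?b"] by simp
    then show ?thesis using b by (simp add: divide_le_0_iff)
  qed simp
  then show ?thesis using that \<open>p \<in> S\<close> by blast
qed

lemma subspace_adjoint_op: "subspace (adjoint_op T)"
  by (auto simp: subspace_def adjoint_op_def zero_prod_def inner_add_right split: prod.splits)

lemma adjoint_opD: "(g, h) \<in> adjoint_op T \<Longrightarrow> (f, k) \<in> T \<Longrightarrow> k \<bullet> g = f \<bullet> h"
  by (auto simp: adjoint_op_def)

lemma adjoint_opI: "(\<And>f k. (f, k) \<in> T \<Longrightarrow> k \<bullet> g = f \<bullet> h) \<Longrightarrow> (g, h) \<in> adjoint_op T"
  by (auto simp: adjoint_op_def)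

locale closed_operator =
  fixes T :: "'h::{real_inner,banach} operator"
  assumes T_subspace: "subspace T" and T_closed: "closed T"
begin

lemma T_add: "(f, g) \<in> T \<Longrightarrow> (f', g') \<in> T \<Longrightarrow> (f + f', g + g') \<in> T"
  and T_diff: "(f, g) \<in> T \<Longrightarrow> (f', g') \<in> T \<Longrightarrow> (f - f', g - g') \<in> T"
  and T_scale: "(f, g) \<in> T \<Longrightarrow> (a *\<^sub>R f, a *\<^sub>R g) \<in> T"
  using subspace_add[OF T_subspace, of "(f, g)" "(f', g')"]
    subspace_diff[OF T_subspace, of "(f, g)" "(f', g')"]
    subspace_scale[OF T_subspace, of "(f, g)" a] by auto

lemma adj_add: "(f, g) \<in> adjoint_op T \<Longrightarrow> (f', g') \<in> adjoint_op T \<Longrightarrow> (f + f', g + g') \<in> adjoint_op T"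
  and adj_diff: "(f, g) \<in> adjoint_op T \<Longrightarrow> (f', g') \<in> adjoint_op T \<Longrightarrow> (f - f', g - g') \<in> adjoint_op T"
  and adj_scale: "(f, g) \<in> adjoint_op T \<Longrightarrow> (a *\<^sub>R f, a *\<^sub>R g) \<in> adjoint_op T"
  using subspace_add[OF subspace_adjoint_op, of "(f, g)" T "(f', g')"]
    subspace_diff[OF subspace_adjoint_op, of "(f, g)" T "(f', g')"]
    subspace_scale[OF subspace_adjoint_op, of "(f, g)" T a] by auto

text \<open>Orthogonal projection onto the graph of \<open>T\<close> when the second component of
  the inner product carries the weight \<open>c\<close>. The product space has only the unweighted
  inner product, so the second component is rescaled by sqrt c. The case \<open>h2 = 0\<close>
  yields the range condition for \<open>TT\<close>, the case \<open>c = 1\<close>,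
  \<open>h1 = 0\<close> yields \<open>B\<close>.\<close>

lemma weighted_projection:
  assumes "c > 0"
  obtains f k where "(f, k) \<in> T" "\<And>f' k'. (f', k') \<in> T \<Longrightarrow> (h1 - f) \<bullet> f' + (h2 - c *\<^sub>R k) \<bullet> k' = 0"
proof -
  define s where "s = sqrt c"
  have s: "s > 0" "s * s = c" using assms by (auto simp: s_def)
  define \<phi> where "\<phi> = (\<lambda>p :: 'h \<times> 'h. (fst p, snd p /\<^sub>R s))"
  have "linear \<phi>" unfolding \<phi>_def by (rule linearI) (auto simp: scaleR_add_right)
  then have sub: "subspace (\<phi> -` T)" by (rule linear_subspace_vimage[OF _ T_subspace])
  have cl: "closed (\<phi> -` T)"
    unfolding \<phi>_def by (intro continuous_closed_vimage T_closed) (auto intro!: continuous_intros)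
  obtain p where p: "p \<in> \<phi> -` T" "\<And>y. y \<in> \<phi> -` T \<Longrightarrow> ((h1, h2 /\<^sub>R s) - p) \<bullet> y = 0"
    using closed_subspace_projection[OF sub cl, of "(h1, h2 /\<^sub>R s)"] by metis
  show ?thesis
  proof (rule that[of "fst p" "snd p /\<^sub>R s"])
    show "(fst p, snd p /\<^sub>R s) \<in> T" using p(1) by (simp add: \<phi>_def)
    fix f' k' assume "(f', k') \<in> T"
    then have "(f', s *\<^sub>R k') \<in> \<phi> -` T" using s by (simp add: \<phi>_def)
    from p(2)[OF this] have "(h1 - fst p) \<bullet> f' + (h2 /\<^sub>R s - snd p) \<bullet> (s *\<^sub>R k') = 0"
      by (simp add: inner_prod_def)
    moreover have "h2 - c *\<^sub>R (snd p /\<^sub>R s) = s *\<^sub>R (h2 /\<^sub>R s - snd p)"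
      using s by (simp add: scaleR_diff_right flip: s(2))
    ultimately show "(h1 - fst p) \<bullet> f' + (h2 - c *\<^sub>R (snd p /\<^sub>R s)) \<bullet> k' = 0" by simp
  qed
qed

abbreviation "TT \<equiv> T O adjoint_op T"

text \<open>For the range condition, (h, 0) is projected onto the graph: orthogonality of the
  remainder to every point of the graph says precisely that (h - f) / c is the value of the adjoint
  at \<open>k\<close>.\<close>

lemma TT_m_accretive:
  assumes "closure (Domain TT) = UNIV"
  shows "m_accretive TT"
proof
  show "subspace TT"
  proof (rule subspaceI)
    show "0 \<in> TT"
      using subspace_0[OF T_subspace] subspace_0[OF subspace_adjoint_op, of T]
      by (auto simp: zero_prod_def)
    show "x + y \<in> TT" if "x \<in> TT" "y \<in> TT" for x y
      using that by (auto intro!: relcompI[OF T_add adj_add])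
    show "a *\<^sub>R x \<in> TT" if "x \<in> TT" for a x
      using that by (auto intro!: relcompI[OF T_scale adj_scale])
  qed
  show "0 \<le> f \<bullet> g" if "(f, g) \<in> TT" for f g
    using that by (auto simp: adjoint_opD[symmetric])
  show "\<exists>f g. (f, g) \<in> TT \<and> f + c *\<^sub>R g = h" if "c > 0" for c h
  proof -
    obtain f k where fk: "(f, k) \<in> T" "\<And>f' k'. (f', k') \<in> T \<Longrightarrow> (h - f) \<bullet> f' + (0 - c *\<^sub>R k) \<bullet> k' = 0"
      using weighted_projection[OF \<open>c > 0\<close>] by metis
    have "(k, (h - f) /\<^sub>R c) \<in> adjoint_op T"
    proof (rule adjoint_opI)
      fix f' k' assume "(f', k') \<in> T"
      from fk(2)[OF this] have "f' \<bullet> (h - f) = c * (k' \<bullet> k)" by (simp add: inner_commute)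
      then show "k' \<bullet> k = f' \<bullet> ((h - f) /\<^sub>R c)"
        using \<open>c > 0\<close> by (simp add: inner_scaleR_right)
    qed
    then have "(f, (h - f) /\<^sub>R c) \<in> TT" using fk(1) by auto
    then show ?thesis using \<open>c > 0\<close> by (intro exI conjI) auto
  qed
qed fact

section \<open>The bounded operator extending the inverse of I + G composed with the adjoint of
  T\<close>

lemma adjoint_system_unique:
  assumes "(f, k) \<in> T" "(h - k, f) \<in> adjoint_op T" "(f', k') \<in> T" "(h - k', f') \<in> adjoint_op T"
  shows "f = f' \<and> k = k'"
proof -
  have "(k - k') \<bullet> ((h - k) - (h - k')) = (f - f') \<bullet> (f - f')"
    by (rule adjoint_opD[OF adj_diff[OF assms(2,4)] T_diff[OF assms(1,3)]])
  then have "(k - k') \<bullet> (k - k') + (f - f') \<bullet> (f - f') = 0"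
    by (simp add: inner_diff)
  then show ?thesis
    by (simp add: add_nonneg_eq_0_iff)
qed

text \<open>\<open>adjoint_solution h\<close> is the pair \<open>(B h, T (B h))\<close>, characterised without reference to the
  inverse of \<open>I + T\<^sup>* T\<close>, so that it is defined for every \<open>h\<close>.\<close>

definition adjoint_solution :: "'h \<Rightarrow> 'h \<times> 'h" where
  "adjoint_solution h = (SOME p. p \<in> T \<and> (h - snd p, fst p) \<in> adjoint_op T)"

definition "solB h = fst (adjoint_solution h)"
definition "solTB h = snd (adjoint_solution h)"

lemma solB_mem: "(solB h, solTB h) \<in> T"
  and solB_adjoint: "(h - solTB h, solB h) \<in> adjoint_op T"
proof -
  obtain f k where fk: "(f, k) \<in> T" "\<And>f' k'. (f', k') \<in> T \<Longrightarrow> (0 - f) \<bullet> f' + (h - 1 *\<^sub>R k) \<bullet> k' = 0"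
    using weighted_projection[OF zero_less_one] by metis
  have "(h - k, f) \<in> adjoint_op T"
  proof (rule adjoint_opI)
    fix f' k' assume "(f', k') \<in> T"
    from fk(2)[OF this] show "k' \<bullet> (h - k) = f' \<bullet> f" by (simp add: inner_commute)
  qed
  then have "\<exists>p. p \<in> T \<and> (h - snd p, fst p) \<in> adjoint_op T" using fk(1) by (intro exI[of _ "(f, k)"]) simp
  then have "adjoint_solution h \<in> T \<and> (h - snd (adjoint_solution h), fst (adjoint_solution h)) \<in> adjoint_op T"
    unfolding adjoint_solution_def by (rule someI_ex)
  then show "(solB h, solTB h) \<in> T" "(h - solTB h, solB h) \<in> adjoint_op T"
    by (auto simp: solB_def solTB_def)
qed

lemma solB_eqI:
  assumes "(f, k) \<in> T" "(h - k, f) \<in> adjoint_op T"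
  shows "solB h = f"
  using adjoint_system_unique[OF solB_mem solB_adjoint assms] by auto

lemma solB_energy: "(norm (solB h))\<^sup>2 + (norm (solTB h))\<^sup>2 = solTB h \<bullet> h"
  using adjoint_opD[OF solB_adjoint solB_mem, of h h] by (simp add: power2_norm_eq_inner inner_diff_right)

lemma solB_norm_le: "norm (solB h) \<le> norm h"
proof -
  have "(norm (solB h))\<^sup>2 + (norm (solTB h))\<^sup>2 \<le> norm (solTB h) * norm h"
    unfolding solB_energy by (rule norm_cauchy_schwarz)
  moreover have "2 * (norm (solTB h) * norm h) \<le> (norm (solTB h))\<^sup>2 + (norm h)\<^sup>2"
    using sum_squares_bound[of "norm (solTB h)" "norm h"] by simp
  moreover have "0 \<le> (norm (solTB h))\<^sup>2" "0 \<le> (norm (solB h))\<^sup>2" by auto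
  ultimately have "(norm (solB h))\<^sup>2 \<le> (norm h)\<^sup>2" by linarith
  then show ?thesis by (rule power2_le_imp_le) simp
qed

lemma solB_bounded_linear: "bounded_linear solB"
proof (rule bounded_linear_intro)
  show "solB (x + y) = solB x + solB y" for x y
    using adj_add[OF solB_adjoint[of x] solB_adjoint[of y]]
    by (intro solB_eqI[OF T_add[OF solB_mem[of x] solB_mem[of y]]]) (simp add: algebra_simps)
  show "solB (a *\<^sub>R x) = a *\<^sub>R solB x" for a x
    using adj_scale[OF solB_adjoint[of x], of a]
    by (intro solB_eqI[OF T_scale[OF solB_mem[of x]]]) (simp add: algebra_simps)
  show "norm (solB x) \<le> norm x * 1" for x using solB_norm_le by simp
qed

text \<open>Write T' for the adjoint. If T' h = w = g + T' T g and k = T g, then T' (h - k) = g,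
  which is the system that defines \<open>solB h\<close>. As I + T' T is onto, the composition is
  defined on all of \<open>Domain (adjoint_op T)\<close>, and the density of that domain makes the
  bounded extension unique.\<close>

lemma bounded_extension_eq:
  assumes dense: "closure (Domain TT) = UNIV" and dense_adj: "closure (Domain (adjoint_op T)) = UNIV"
  shows "bounded_extension (adjoint_op T O (id_plus TT)\<inverse>) = solB"
proof -
  interpret G: m_accretive TT by (rule TT_m_accretive[OF dense])
  let ?C = "adjoint_op T O (id_plus TT)\<inverse>"
  have eq: "solB h = g" if "(h, g) \<in> ?C" for h g
  proof -
    obtain w where w: "(h, w) \<in> adjoint_op T" "(g, w) \<in> id_plus TT" using \<open>(h, g) \<in> ?C\<close> by auto
    then obtain k where k: "(g, k) \<in> T" "(k, w - g) \<in> adjoint_op T"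
      by (auto simp: id_plus_def)
    have "(h - k, g) \<in> adjoint_op T" using adj_diff[OF w(1) k(2)] by simp
    then show ?thesis by (rule solB_eqI[OF k(1)])
  qed
  show ?thesis
    unfolding bounded_extension_def
  proof (rule the_equality)
    show "bounded_linear solB \<and> (\<forall>(f, g)\<in>?C. solB f = g)"
      using eq by (intro conjI solB_bounded_linear) (simp add: split_beta)
    fix B' assume B': "bounded_linear B' \<and> (\<forall>(f, g)\<in>?C. B' f = g)"
    have on: "B' h = solB h" if "h \<in> Domain (adjoint_op T)" for h
    proof -
      from that obtain w where w: "(h, w) \<in> adjoint_op T" by (rule DomainE)
      obtain g v where g: "(g, v) \<in> TT" "g + 1 *\<^sub>R v = w" using G.range[OF zero_less_one, of w] by (elim exE conjE)
      then have "(g, w) \<in> id_plus TT" unfolding id_plus_def by force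
      then have hg: "(h, g) \<in> ?C" using w by auto
      then have "B' h = g" using bspec[OF conjunct2[OF B'] hg] by simp
      then show ?thesis using eq[OF hg] by simp
    qed
    have "closed {h. B' h = solB h}"
      using B' solB_bounded_linear by (intro closed_Collect_eq linear_continuous_on) auto
    then have "closure (Domain (adjoint_op T)) \<subseteq> {h. B' h = solB h}"
      using on by (intro closure_minimal) auto
    then show "B' = solB" using dense_adj by auto
  qed
qed

end

section \<open>From a weak Poincare inequality along an orbit to a resolvent estimate\<close>

context closed_operator
begin

text \<open>Only the orbit \<open>e\<^sup>-\<^sup>t\<^sup>G x\<close> is assumed to satisfy the weak Poincare inequality; it reaches the
  resolvent through \<open>(I + G)\<^sup>-\<^sup>1 = \<integral>e\<^sup>-\<^sup>t e\<^sup>-\<^sup>t\<^sup>G dt\<close>, here in the guise of a comparison of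
  \<open>e\<^sup>-\<^sup>t \<langle>(I + G)\<^sup>-\<^sup>1 e\<^sup>-\<^sup>t\<^sup>G x, v\<rangle>\<close> with an explicit function of \<open>t\<close>.\<close>

lemma weak_Poincare_resolvent:
  assumes dense: "closure (Domain TT) = UNIV" and x: "x \<in> Domain TT" and \<alpha>: "\<alpha> \<ge> 1"
    and wp: "\<And>t k. t \<ge> 0 \<Longrightarrow> (exp_semigroup (neg_op TT) t x, k) \<in> T \<Longrightarrow>
      (norm (exp_semigroup (neg_op TT) t x))\<^sup>2 \<le> \<alpha> * (norm k)\<^sup>2 + m"
  shows "(norm x)\<^sup>2 \<le> (\<alpha> + 2) * (m_accretive.yosida TT 1 x \<bullet> x) + m"
proof -
  interpret G: m_accretive TT by (rule TT_m_accretive[OF dense])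
  define P where "P = G.semigroup"
  have gen: "generates_semigroup (neg_op TT) P" unfolding P_def by (rule G.generates_semigroup)
  then have C0: "C0_contraction_semigroup P" and gen_eq: "generator P = neg_op TT"
    by (auto simp: generates_semigroup_def)
  have "Domain (neg_op TT) = Domain TT" by (auto simp: neg_op_def Domain_iff)
  then have exp_eq: "exp_semigroup (neg_op TT) t x = P t x" if "t \<ge> 0" for t
    using dense by (intro exp_semigroup_eq[OF gen _ that]) simp
  obtain g where xg: "(x, g) \<in> TT" using x by (rule DomainE)
  then have xg': "(x, - g) \<in> generator P" unfolding gen_eq by (auto simp: neg_op_def)
  define u where "u t = P t x" for t
  define w where "w t = P t (- g)" for t
  have u0: "u 0 = x" by (simp add: u_def C0_zero[OF C0])
  have u_deriv: "(u has_vector_derivative w t) (at t within {0..})" if "t \<ge> 0" for t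
    using semigroup_derivative[OF C0 xg' that] by (simp add: u_def[abs_def] w_def)
  have u_mem: "(u t, - w t) \<in> TT" if "t \<ge> 0" for t
    using generator_invariant[OF C0 xg' that] by (auto simp: gen_eq neg_op_def u_def w_def)
  have decay: "(norm (u t))\<^sup>2 \<le> m + exp (- (2 / \<alpha>) * t) * ((norm (u 0))\<^sup>2 - m)" if "t \<ge> 0" for t
  proof (rule halfline_gronwall[OF norm_square_derivative[OF u_deriv] _ that])
    fix t :: real assume t: "t \<ge> 0"
    obtain k where k: "(u t, k) \<in> T" "(k, - w t) \<in> adjoint_op T" using u_mem[OF t] by auto
    have "(norm k)\<^sup>2 = u t \<bullet> - w t"
      using adjoint_opD[OF k(2,1)] by (simp add: power2_norm_eq_inner)
    moreover have "(norm (u t))\<^sup>2 \<le> \<alpha> * (norm k)\<^sup>2 + m"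
      using wp[OF t, of k] k(1) by (simp add: exp_eq[OF t] u_def)
    ultimately have "2 * (norm (u t))\<^sup>2 \<le> \<alpha> * (- 2 * (u t \<bullet> w t)) + 2 * m" by simp
    then show "2 * (u t \<bullet> w t) \<le> (2 / \<alpha>) * (m - (norm (u t))\<^sup>2)"
      using \<alpha> by (simp add: field_simps)
  qed
  define R where "R z = z - G.yosida 1 z" for z
  have R: "bounded_linear R"
    unfolding R_def by (intro bounded_linear_sub bounded_linear_ident G.yosida_bounded_linear) simp
  have R_eq: "R (z + y) = z" if "(z, y) \<in> TT" for z y
    using G.yosida_eqI[of 1 "z + y" y] that by (simp add: R_def)
  define v where "v = R x"
  define \<phi> where "\<phi> = (norm x)\<^sup>2"
  \<comment> \<open>By \<open>decay\<close> and Young's inequality, e^(-s) <u s, v> is at most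
    e^(-s) (|v|^2 + m + e^(-2 s / \<alpha>) (\<phi> - m)) / 2. \<open>K t\<close> is the integral of
    this majorant over s \<ge> t, and e^(-t) <R (u t), v> is the integral of e^(-s) <u s, v> itself.
    Hence their difference \<open>D\<close> is nonincreasing.\<close>
  define K where "K t = exp (- t) * (v \<bullet> v + m) / 2
      + \<alpha> / (\<alpha> + 2) * (exp (- (1 + 2 / \<alpha>) * t) * (\<phi> - m)) / 2" for t :: real
  define D where "D t = K t - exp (- t) * (R (u t) \<bullet> v)" for t
  define D' where "D' t = - (exp (- t) * (v \<bullet> v + m) / 2) - exp (- (1 + 2 / \<alpha>) * t) * (\<phi> - m) / 2
      + exp (- t) * (u t \<bullet> v)" for t
  have D_deriv: "(D has_real_derivative D' t) (at t within {0..})" if t: "t \<ge> 0" for t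
  proof -
    have "((\<lambda>t. R (u t) \<bullet> v) has_vector_derivative R (w t) \<bullet> v) (at t within {0..})"
      by (rule bounded_linear.has_vector_derivative[OF bounded_linear_inner_left
            bounded_linear.has_vector_derivative[OF R u_deriv[OF t]]])
    then have Rd: "((\<lambda>t. R (u t) \<bullet> v) has_real_derivative R (w t) \<bullet> v) (at t within {0..})"
      by (simp add: has_real_derivative_iff_has_vector_derivative)
    have "u t = R (u t) - R (w t)"
      using R_eq[OF u_mem[OF t]] by (simp add: linear_diff[OF bounded_linear.linear[OF R]])
    then have uv: "u t \<bullet> v = R (u t) \<bullet> v - R (w t) \<bullet> v" by (metis inner_diff_left)
    have "1 + 2 / \<alpha> = (\<alpha> + 2) / \<alpha>" using \<alpha> by (simp add: field_simps)
    then have "\<alpha> / (\<alpha> + 2) * (- (1 + 2 / \<alpha>)) = - 1" using \<alpha> by simp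
    moreover have "(K has_real_derivative - (exp (- t) * (v \<bullet> v + m) / 2)
        + (\<alpha> / (\<alpha> + 2) * (- (1 + 2 / \<alpha>))) * (exp (- (1 + 2 / \<alpha>) * t) * (\<phi> - m)) / 2) (at t within {0..})"
      unfolding K_def using \<alpha> by (auto intro!: derivative_eq_intros)
    ultimately have Kd: "(K has_real_derivative - (exp (- t) * (v \<bullet> v + m) / 2)
        + (- 1) * (exp (- (1 + 2 / \<alpha>) * t) * (\<phi> - m)) / 2) (at t within {0..})"
      by (simp only:)
    have Ed: "((\<lambda>t. exp (- t) * (R (u t) \<bullet> v)) has_real_derivative - (exp (- t) * (u t \<bullet> v))) (at t within {0..})"
      unfolding uv by (auto intro!: derivative_eq_intros Rd simp: algebra_simps)
    show ?thesis
      unfolding D_def D'_def by (rule DERIV_cong[OF DERIV_diff[OF Kd Ed]]) simp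
  qed
  have D'_le: "D' t \<le> 0" if t: "t \<ge> 0" for t
  proof -
    have "2 * (u t \<bullet> v) \<le> (norm (u t))\<^sup>2 + v \<bullet> v"
      using inner_ge_zero[of "u t - v"] by (simp add: inner_diff inner_commute power2_norm_eq_inner)
    then have "exp (- t) * (2 * (u t \<bullet> v)) \<le> exp (- t) * (m + exp (- (2 / \<alpha>) * t) * (\<phi> - m) + v \<bullet> v)"
      using decay[OF t] by (intro mult_left_mono) (auto simp: u0 \<phi>_def)
    moreover have "exp (- (1 + 2 / \<alpha>) * t) = exp (- t) * exp (- (2 / \<alpha>) * t)"
      by (simp add: algebra_simps flip: exp_add)
    ultimately show ?thesis
      unfolding D'_def by (simp add: algebra_simps add_divide_distrib diff_divide_distrib)
  qed
  \<comment> \<open>\<open>C\<close> collects the absolute values of all terms of \<open>D\<close>,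
    each of which decays at least like e^(-t). Thus D 0 \<ge> D t \<ge> - e^(-t) C, and letting t
    tend to infinity gives D 0 \<ge> 0.\<close>
  define C where "C = \<bar>v \<bullet> v + m\<bar> / 2 + \<alpha> / (\<alpha> + 2) * \<bar>\<phi> - m\<bar> / 2 + norm x * norm v"
  have mult_ge: "- (p * \<bar>y\<bar>) \<le> p * y" if "0 \<le> p" for p y :: real
  proof -
    have "- \<bar>y\<bar> \<le> y" by linarith
    from mult_left_mono[OF this that] show ?thesis by simp
  qed
  have D_ge: "- (exp (- t) * C) \<le> D 0" if t: "t \<ge> 0" for t
  proof -
    have 1: "exp (- t) * (v \<bullet> v + m) \<ge> - (exp (- t) * \<bar>v \<bullet> v + m\<bar>)"
      by (rule mult_ge) simp
    have "exp (- (1 + 2 / \<alpha>) * t) \<le> exp (- t)" using t \<alpha> by (simp add: algebra_simps)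
    then have "exp (- (1 + 2 / \<alpha>) * t) * \<bar>\<phi> - m\<bar> \<le> exp (- t) * \<bar>\<phi> - m\<bar>" by (intro mult_right_mono) auto
    moreover have "- (exp (- (1 + 2 / \<alpha>) * t) * \<bar>\<phi> - m\<bar>) \<le> exp (- (1 + 2 / \<alpha>) * t) * (\<phi> - m)"
      by (rule mult_ge) simp
    ultimately have "- (exp (- t) * \<bar>\<phi> - m\<bar>) \<le> exp (- (1 + 2 / \<alpha>) * t) * (\<phi> - m)" by linarith
    then have 2: "\<alpha> / (\<alpha> + 2) * - (exp (- t) * \<bar>\<phi> - m\<bar>)
        \<le> \<alpha> / (\<alpha> + 2) * (exp (- (1 + 2 / \<alpha>) * t) * (\<phi> - m))"
      using \<alpha> by (intro mult_left_mono) auto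
    have "R (u t) \<bullet> v \<le> norm (R (u t)) * norm v" by (rule norm_cauchy_schwarz)
    also have "norm (R (u t)) \<le> norm (u t)"
      using G.resolvent_norm_le[of 1 "u t"] by (simp add: R_def)
    also have "norm (u t) \<le> norm x" using C0_norm_le[OF C0 t] by (simp add: u_def)
    finally have "R (u t) \<bullet> v \<le> norm x * norm v" by (simp add: mult_right_mono)
    then have 3: "exp (- t) * (R (u t) \<bullet> v) \<le> exp (- t) * (norm x * norm v)"
      by (intro mult_left_mono) auto
    define w where "w = \<alpha> / (\<alpha> + 2)"
    have "exp (- t) * C = exp (- t) * \<bar>v \<bullet> v + m\<bar> / 2 + w * (exp (- t) * \<bar>\<phi> - m\<bar>) / 2
        + exp (- t) * (norm x * norm v)"
      unfolding C_def w_def[symmetric] by (simp only: distrib_left times_divide_eq_right mult.left_commute)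
    moreover have "- (w * (exp (- t) * \<bar>\<phi> - m\<bar>)) \<le> w * (exp (- (1 + 2 / \<alpha>) * t) * (\<phi> - m))"
      using 2 unfolding w_def[symmetric] by simp
    ultimately have "- (exp (- t) * C) \<le> D t"
      using 1 3 unfolding D_def K_def w_def[symmetric] by linarith
    also have "D t \<le> D 0" by (rule halfline_antimono[OF D_deriv D'_le _ t]) auto
    finally show ?thesis .
  qed
  have "0 \<le> D 0"
  proof (rule tendsto_upperbound)
    have "((\<lambda>t::real. exp (- t)) \<longlongrightarrow> 0) at_top"
      using filterlim_compose[OF exp_at_bot filterlim_uminus_at_bot_at_top] by simp
    then show "((\<lambda>t. - (exp (- t) * C)) \<longlongrightarrow> 0) at_top"
      by (intro tendsto_minus[where a = 0, simplified] tendsto_mult_left_zero)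
    show "\<forall>\<^sub>F t in at_top. - (exp (- t) * C) \<le> D 0"
      using eventually_ge_at_top[of 0] by eventually_elim (rule D_ge)
  qed simp
  then have "v \<bullet> v \<le> exp (- 0) * (v \<bullet> v + m) / 2 + \<alpha> / (\<alpha> + 2) * (exp (- (1 + 2 / \<alpha>) * 0) * (\<phi> - m)) / 2"
    unfolding D_def K_def u0 v_def[symmetric] by simp
  moreover have "2 * a \<le> b + c" if "a \<le> b / 2 + c / 2" for a b c :: real
    using that by simp
  ultimately have "2 * (v \<bullet> v) \<le> (v \<bullet> v + m) + \<alpha> / (\<alpha> + 2) * (\<phi> - m)"
    unfolding mult_zero_right minus_zero exp_zero mult_1 by blast
  then have "(\<alpha> + 2) * (v \<bullet> v - m) \<le> (\<alpha> + 2) * (\<alpha> / (\<alpha> + 2) * (\<phi> - m))"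
    using \<alpha> by (intro mult_left_mono) auto
  also have "\<dots> = \<alpha> * (\<phi> - m)" using \<alpha> by simp
  finally have v_le: "(\<alpha> + 2) * (v \<bullet> v) \<le> \<alpha> * \<phi> + 2 * m" by (simp add: algebra_simps)
  \<comment> \<open>With y the Yosida value at x, v = x - y, so |x|^2 - |v|^2 = 2 <y, x> -
    |y|^2.\<close>
  have "\<phi> - v \<bullet> v \<le> 2 * (G.yosida 1 x \<bullet> x)"
    using inner_ge_zero[of "G.yosida 1 x"]
    by (simp add: \<phi>_def v_def R_def power2_norm_eq_inner inner_diff inner_commute)
  then have "(\<alpha> + 2) * (\<phi> - v \<bullet> v) \<le> (\<alpha> + 2) * (2 * (G.yosida 1 x \<bullet> x))"
    using \<alpha> by (intro mult_left_mono) auto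
  then show ?thesis using v_le by (simp add: \<phi>_def algebra_simps)
qed

end

text \<open>Here a and b are the norms of pi1 f and pi2 f, E = <-L f, f>, X is the derivative of <B
  f, f>, A = \<alpha>1(r) and C = \<alpha>2(r / A^2). After multiplication by 30 N^2 A^2 C, the
  dissipation contributes -30 N^2 A^2 b^2 and the term -6 A Q contributes -2 a^2. The products cost
  6 A N a b \<le> a^2 + 9 N^2 A^2 b^2 and 6 A b^2 \<le> 6 N^2 A^2 b^2, so -a^2 - 15 N^2 A^2 b^2 is
  left. The two errors 30 N^2 r m and 2 r m make up 32 N^2 r m; the level r / A^2 is what cancels
  A^2 in the first of them.\<close>

lemma hypocoercive_balance:
  fixes a b :: real
  assumes "A \<ge> 1" "C \<ge> 1" "N \<ge> 1" "r \<ge> 0" "m \<ge> 0"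
    and a: "a\<^sup>2 \<le> 3 * A * Q + r * m" and b: "b\<^sup>2 \<le> C * E + r / A\<^sup>2 * m"
    and X: "X \<le> N * a * b + b\<^sup>2 - Q"
  shows "- E + 1 / (5 * N\<^sup>2 * A * C) * X \<le> 1 / (30 * N\<^sup>2 * A\<^sup>2 * C) * (32 * N\<^sup>2 * r * m - (a\<^sup>2 + b\<^sup>2))"
proof -
  define c where "c = 30 * N\<^sup>2 * A\<^sup>2 * C"
  have c: "c > 0" using assms by (simp add: c_def)
  have "30 * N\<^sup>2 * A\<^sup>2 * b\<^sup>2 \<le> 30 * N\<^sup>2 * A\<^sup>2 * (C * E + r / A\<^sup>2 * m)"
    using b by (intro mult_left_mono) auto
  also have "\<dots> = c * E + 30 * N\<^sup>2 * r * m" using \<open>A \<ge> 1\<close> by (simp add: c_def field_simps)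
  finally have 1: "- (c * E) \<le> - (30 * N\<^sup>2 * A\<^sup>2 * b\<^sup>2) + 30 * N\<^sup>2 * (r * m)" by (simp add: ac_simps)
  have 2: "6 * A * X \<le> 6 * A * (N * a * b + b\<^sup>2 - Q)"
    using X \<open>A \<ge> 1\<close> by (intro mult_left_mono) auto
  have "0 \<le> (a - 3 * A * N * b)\<^sup>2" by simp
  then have 3: "6 * A * (N * a * b) \<le> a\<^sup>2 + 9 * N\<^sup>2 * A\<^sup>2 * b\<^sup>2"
    by (simp add: power2_eq_square algebra_simps)
  have N2: "1 \<le> N\<^sup>2" using \<open>N \<ge> 1\<close> by simp
  have "A * 1 \<le> A * A" using \<open>A \<ge> 1\<close> by (intro mult_left_mono) auto
  also have "A * A \<le> N\<^sup>2 * A\<^sup>2" using mult_right_mono[OF N2, of "A\<^sup>2"] by (simp add: power2_eq_square)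
  finally have A: "A \<le> N\<^sup>2 * A\<^sup>2" by simp
  then have 4: "6 * A * b\<^sup>2 \<le> 6 * N\<^sup>2 * A\<^sup>2 * b\<^sup>2" using mult_right_mono[OF A, of "b\<^sup>2"] by simp
  have 5: "b\<^sup>2 \<le> N\<^sup>2 * A\<^sup>2 * b\<^sup>2" using mult_right_mono[of 1 "N\<^sup>2 * A\<^sup>2" "b\<^sup>2"] A \<open>A \<ge> 1\<close> by simp
  have 6: "r * m \<le> N\<^sup>2 * (r * m)" using mult_right_mono[OF N2, of "r * m"] assms by simp
  define b2 where "b2 = N\<^sup>2 * A\<^sup>2 * b\<^sup>2"
  have "b\<^sup>2 \<le> 15 * b2" using 5 zero_le_power2[of b] unfolding b2_def by linarith
  moreover have "- (c * E) \<le> - 30 * b2 + 30 * (N\<^sup>2 * (r * m))" using 1 by (simp add: b2_def ac_simps)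
  moreover have "6 * A * X \<le> 6 * A * (N * a * b) + 6 * A * b\<^sup>2 - 2 * (3 * A * Q)"
    using 2 by (simp add: algebra_simps)
  moreover have "6 * A * (N * a * b) \<le> a\<^sup>2 + 9 * b2" using 3 by (simp add: b2_def ac_simps)
  moreover have "6 * A * b\<^sup>2 \<le> 6 * b2" using 4 by (simp add: b2_def ac_simps)
  ultimately have "- (c * E) + 6 * A * X \<le> 32 * (N\<^sup>2 * (r * m)) - (a\<^sup>2 + b\<^sup>2)"
    using a 6 by linarith
  moreover have "6 * A * X = c * (1 / (5 * N\<^sup>2 * A * C) * X)"
    using assms by (simp add: c_def power2_eq_square field_simps)
  ultimately have "c * (- E + 1 / (5 * N\<^sup>2 * A * C) * X) \<le> 32 * N\<^sup>2 * r * m - (a\<^sup>2 + b\<^sup>2)"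
    unfolding distrib_left by (simp only: mult_minus_right mult.assoc)
  then have "- E + 1 / (5 * N\<^sup>2 * A * C) * X \<le> (32 * N\<^sup>2 * r * m - (a\<^sup>2 + b\<^sup>2)) / c"
    using c by (simp add: pos_le_divide_eq mult.commute)
  then show ?thesis by (simp add: c_def)
qed

section \<open>Hypocoercive decay\<close>

lemma app_eqI: "single_valued T \<Longrightarrow> (f, g) \<in> T \<Longrightarrow> app T f = g"
  unfolding app_def by (auto dest: single_valuedD)

section \<open>Closures of symmetric and antisymmetric operators\<close>

lemma dense_orthogonal_eq_0:
  fixes x :: "'h::real_inner"
  assumes "closure D = UNIV" "\<And>f. f \<in> D \<Longrightarrow> x \<bullet> f = 0"
  shows "x = 0"
proof -
  have "closed {f. x \<bullet> f = 0}" by (intro closed_Collect_eq continuous_intros)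
  then have "closure D \<subseteq> {f. x \<bullet> f = 0}" using assms(2) by (intro closure_minimal) auto
  then have "x \<in> {f. x \<bullet> f = 0}" using assms(1) by blast
  then show ?thesis by simp
qed

text \<open>\<open>\<sigma>\<close> is 1 for symmetric and -1 for antisymmetric operators. The
  identity is a closed condition on pairs of graph points, and the closure of a product is the
  product of the closures.\<close>

lemma closure_pairing:
  fixes T :: "'h::real_inner operator"
  assumes T: "\<And>f g f' g'. (f, g) \<in> T \<Longrightarrow> (f', g') \<in> T \<Longrightarrow> g \<bullet> f' = \<sigma> * (f \<bullet> g')"
    and "(f, g) \<in> closure T" "(f', g') \<in> closure T"
  shows "g \<bullet> f' = \<sigma> * (f \<bullet> g')"
proof -
  let ?C = "{p :: ('h \<times> 'h) \<times> ('h \<times> 'h).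
    snd (fst p) \<bullet> fst (snd p) = \<sigma> * (fst (fst p) \<bullet> snd (snd p))}"
  have "closed ?C" by (intro closed_Collect_eq continuous_intros)
  then have "closure (T \<times> T) \<subseteq> ?C" using T by (intro closure_minimal) auto
  then show ?thesis using assms(2,3) by (force simp: closure_Times)
qed

text \<open>Closability: two values at \<open>f\<close> have the same inner product with every
  element of the dense domain, because the pairing moves the operator onto that element.\<close>

lemma closure_single_valued:
  fixes T :: "'h::real_inner operator"
  assumes T: "\<And>f g f' g'. (f, g) \<in> T \<Longrightarrow> (f', g') \<in> T \<Longrightarrow> g \<bullet> f' = \<sigma> * (f \<bullet> g')"
    and dense: "closure (Domain T) = UNIV"
  shows "single_valued (closure T)"
proof (rule single_valuedI)
  fix f g g' assume g: "(f, g) \<in> closure T" "(f, g') \<in> closure T"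
  have "g - g' = 0"
  proof (rule dense_orthogonal_eq_0[OF dense])
    fix h assume "h \<in> Domain T"
    then obtain k where "(h, k) \<in> T" by (rule DomainE)
    then have hk: "(h, k) \<in> closure T" using closure_subset by blast
    show "(g - g') \<bullet> h = 0"
      using closure_pairing[OF T g(1) hk] closure_pairing[OF T g(2) hk] by (simp add: inner_diff_left)
  qed
  then show "g = g'" by simp
qed

lemma closure_subspace:
  fixes T :: "'a::real_normed_vector set"
  assumes "subspace T"
  shows "subspace (closure T)"
proof (rule subspaceI)
  show "0 \<in> closure T" using subspace_0[OF assms] closure_subset by blast
next
  fix x y assume "x \<in> closure T" "y \<in> closure T"
  then obtain u v where "\<And>n. u n \<in> T" "u \<longlonglongrightarrow> x" "\<And>n. v n \<in> T" "v \<longlonglongrightarrow> y"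
    by (auto simp: closure_sequential)
  then show "x + y \<in> closure T"
    unfolding closure_sequential
    by (intro exI[of _ "\<lambda>n. u n + v n"]) (auto intro: tendsto_add subspace_add[OF assms])
next
  fix c and x assume "x \<in> closure T"
  then obtain u where "\<And>n. u n \<in> T" "u \<longlonglongrightarrow> x" by (auto simp: closure_sequential)
  then show "c *\<^sub>R x \<in> closure T"
    unfolding closure_sequential
    by (intro exI[of _ "\<lambda>n. c *\<^sub>R u n"]) (auto intro: tendsto_scaleR tendsto_const subspace_scale[OF assms])
qed

lemma closure_Domain_subset:
  fixes T :: "'h::real_normed_vector operator"
  assumes "(f, g) \<in> closure T"
  shows "f \<in> closure (Domain T)"
proof -
  have "closure T \<subseteq> closure (Domain T) \<times> UNIV"
    by (rule closure_minimal) (auto intro: closed_Times closure_subset[THEN subsetD])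
  then show ?thesis using assms by auto
qed

lemma ennreal_le_add_mult_boundD:
  assumes "ennreal x \<le> ennreal y + ennreal r * \<psi>" "\<psi> \<le> ennreal m" "0 \<le> y" "0 \<le> r" "0 \<le> m"
  shows "x \<le> y + r * m"
proof -
  have "ennreal x \<le> ennreal y + ennreal r * ennreal m"
    using assms(1,2) by (meson add_left_mono mult_left_mono order_trans zero_le)
  also have "\<dots> = ennreal (y + r * m)"
    using assms by (simp add: ennreal_mult ennreal_plus)
  finally show ?thesis using assms by (subst (asm) ennreal_le_iff) auto
qed

locale hypocoercive =
  fixes P :: "real \<Rightarrow> 'h::{real_inner, banach} \<Rightarrow> 'h"
    and L S0 A0 S A A\<pi>1 G :: "'h operator"
    and B \<pi>1 \<pi>2 :: "'h \<Rightarrow> 'h"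
    and D H1 H2 :: "'h set"
    and \<Psi> :: "'h \<Rightarrow> ennreal"
    and \<alpha>1 \<alpha>2 :: "real \<Rightarrow> real"
    and N :: real
  assumes separable: "separable_space (euclidean :: 'h topology)"
    and L_operator: "linear_operator L" "closure (Domain L) = UNIV"
    and L_generates: "generates_semigroup L P"
    and core: "core_of D L"
    and S0_operator: "linear_operator S0" "Domain S0 = D" "symmetric_op S0"
    and A0_operator: "linear_operator A0" "Domain A0 = D" "antisymmetric_op A0"
    and L_eq: "\<And>f. f \<in> D \<Longrightarrow> app L f = app S0 f - app A0 f"
    and S_eq: "S = closure S0"
    and A_eq: "A = closure A0"
    and decomposition: "orthogonal_decomposition H1 H2 \<pi>1 \<pi>2"
    and \<Psi>_dense: "closure {f. \<Psi> f < \<infinity>} = UNIV"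
    and A\<pi>1_eq: "A\<pi>1 = precomp A \<pi>1"
    and G_eq: "G = A\<pi>1 O adjoint_op A\<pi>1"
    and B_eq: "B = bounded_extension (adjoint_op A\<pi>1 O (id_plus G)\<inverse>)"
    and hyp1: "H1 \<subseteq> {f \<in> Domain S. app S f = 0}"
    and hyp2: "\<pi>1 ` D \<subseteq> Domain A" "\<And>f. f \<in> D \<Longrightarrow> \<pi>1 (app A (\<pi>1 f)) = 0"
    and hyp3: "D \<subseteq> Domain G" "N \<ge> 1"
      "\<And>f. f \<in> D \<Longrightarrow> B (app S (\<pi>2 f)) \<bullet> \<pi>1 f \<le> N / 2 * norm (\<pi>1 f) * norm (\<pi>2 f)"
      "\<And>f. f \<in> D \<Longrightarrow> - (B (app A (\<pi>2 f)) \<bullet> \<pi>1 f) \<le> N / 2 * norm (\<pi>1 f) * norm (\<pi>2 f)"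
    and hyp4: "\<And>f. f \<in> Domain L \<Longrightarrow>
      \<exists>F :: nat \<Rightarrow> 'h. (\<forall>n. F n \<in> D) \<and> F \<longlonglongrightarrow> f \<and>
        limsup (\<lambda>n. ereal (- app L (F n) \<bullet> F n)) \<le> ereal (- app L f \<bullet> f) \<and>
        limsup (\<lambda>n. \<Psi> (F n)) \<le> \<Psi> f"
    and \<Psi>_P: "\<And>t f. t \<ge> 0 \<Longrightarrow> \<Psi> (P t f) \<le> \<Psi> f"
    and \<Psi>_exp_G: "\<And>t f. t \<ge> 0 \<Longrightarrow> \<Psi> (exp_semigroup (neg_op G) t f) \<le> \<Psi> f"
    and \<Psi>_\<pi>1: "\<And>f. \<Psi> (\<pi>1 f) \<le> \<Psi> f"
    and \<alpha>1: "antimono_on {0<..} \<alpha>1" "\<And>r. r > 0 \<Longrightarrow> \<alpha>1 r \<ge> 1"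
    and \<alpha>2: "antimono_on {0<..} \<alpha>2" "\<And>r. r > 0 \<Longrightarrow> \<alpha>2 r \<ge> 1"
    and weak_Poincare1: "\<And>r f. r > 0 \<Longrightarrow> f \<in> Domain A\<pi>1 \<Longrightarrow>
      ennreal ((norm (\<pi>1 f))\<^sup>2) \<le> ennreal (\<alpha>1 r * (norm (app A\<pi>1 f))\<^sup>2) + ennreal r * \<Psi> (\<pi>1 f)"
    and weak_Poincare2: "\<And>r f. r > 0 \<Longrightarrow> f \<in> D \<Longrightarrow>
      ennreal ((norm (\<pi>2 f))\<^sup>2) \<le> ennreal (\<alpha>2 r * (- app S f \<bullet> f)) + ennreal r * \<Psi> f"
begin

section \<open>The orthogonal decomposition\<close>

lemma proj_H1 [simp]: "\<pi>1 f \<in> H1" and proj_H2 [simp]: "\<pi>2 f \<in> H2" and proj_add: "\<pi>1 f + \<pi>2 f = f"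
  and H1_subspace: "subspace H1" and H2_subspace: "subspace H2"
  and H_orthogonal: "g \<in> H1 \<Longrightarrow> h \<in> H2 \<Longrightarrow> g \<bullet> h = 0"
  using decomposition unfolding orthogonal_decomposition_def orthogonal_def by metis+

lemma proj_unique:
  assumes "g \<in> H1" "h \<in> H2" "g + h = f"
  shows "\<pi>1 f = g" "\<pi>2 f = h"
proof -
  have eq: "\<pi>1 f - g = h - \<pi>2 f" using assms(3) proj_add[of f] by (simp add: algebra_simps)
  have "\<pi>1 f - g \<in> H1" "h - \<pi>2 f \<in> H2"
    using assms by (auto intro: subspace_diff H1_subspace H2_subspace)
  then have "(\<pi>1 f - g) \<bullet> (\<pi>1 f - g) = 0" using H_orthogonal eq by metis
  then show "\<pi>1 f = g" "\<pi>2 f = h" using eq by auto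
qed

lemma norm_decomposition: "(norm f)\<^sup>2 = (norm (\<pi>1 f))\<^sup>2 + (norm (\<pi>2 f))\<^sup>2"
proof -
  have "(norm (\<pi>1 f + \<pi>2 f))\<^sup>2 = (norm (\<pi>1 f))\<^sup>2 + (norm (\<pi>2 f))\<^sup>2"
    using H_orthogonal[of "\<pi>1 f" "\<pi>2 f"] unfolding power2_norm_eq_inner
    by (simp add: inner_add inner_commute)
  then show ?thesis by (simp add: proj_add)
qed

lemma proj_bounded_linear: "bounded_linear \<pi>1" "bounded_linear \<pi>2"
proof -
  have le: "norm (\<pi>1 x) \<le> norm x" "norm (\<pi>2 x) \<le> norm x" for x
    by (rule power2_le_imp_le; simp add: norm_decomposition[of x])+
  have add: "\<pi>1 (x + y) = \<pi>1 x + \<pi>1 y" "\<pi>2 (x + y) = \<pi>2 x + \<pi>2 y" for x y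
  proof -
    have "\<pi>1 x + \<pi>1 y + (\<pi>2 x + \<pi>2 y) = x + y"
      using proj_add[of x] proj_add[of y] by (simp add: algebra_simps)
    then show "\<pi>1 (x + y) = \<pi>1 x + \<pi>1 y" "\<pi>2 (x + y) = \<pi>2 x + \<pi>2 y"
      by (intro proj_unique subspace_add H1_subspace H2_subspace; simp)+
  qed
  have scale: "\<pi>1 (a *\<^sub>R x) = a *\<^sub>R \<pi>1 x" "\<pi>2 (a *\<^sub>R x) = a *\<^sub>R \<pi>2 x" for a x
  proof -
    have "a *\<^sub>R \<pi>1 x + a *\<^sub>R \<pi>2 x = a *\<^sub>R x" by (simp add: proj_add flip: scaleR_add_right)
    then show "\<pi>1 (a *\<^sub>R x) = a *\<^sub>R \<pi>1 x" "\<pi>2 (a *\<^sub>R x) = a *\<^sub>R \<pi>2 x"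
      by (intro proj_unique subspace_scale H1_subspace H2_subspace; simp)+
  qed
  show "bounded_linear \<pi>1" "bounded_linear \<pi>2"
    using add scale le by (auto intro!: bounded_linear_intro[of _ 1])
qed

sublocale p1: bounded_linear \<pi>1 by (rule proj_bounded_linear)
sublocale p2: bounded_linear \<pi>2 by (rule proj_bounded_linear)

lemma proj_on: "g \<in> H1 \<Longrightarrow> \<pi>1 g = g" "g \<in> H1 \<Longrightarrow> \<pi>2 g = 0" "h \<in> H2 \<Longrightarrow> \<pi>1 h = 0" "h \<in> H2 \<Longrightarrow> \<pi>2 h = h"
  by (rule proj_unique; use subspace_0[OF H1_subspace] subspace_0[OF H2_subspace] in simp)+

lemma proj1_inner: "\<pi>1 f \<bullet> g = f \<bullet> \<pi>1 g"
proof -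
  have "\<pi>1 f \<bullet> (\<pi>1 g + \<pi>2 g) = (\<pi>1 f + \<pi>2 f) \<bullet> \<pi>1 g"
    using H_orthogonal[of "\<pi>1 f" "\<pi>2 g"] H_orthogonal[of "\<pi>1 g" "\<pi>2 f"]
    by (simp add: inner_add inner_commute)
  then show ?thesis by (simp add: proj_add)
qed

lemma mem_H1I: "\<pi>2 f = 0 \<Longrightarrow> f \<in> H1" and mem_H2I: "\<pi>1 f = 0 \<Longrightarrow> f \<in> H2"
  using proj_add[of f] proj_H1[of f] proj_H2[of f] by auto

section \<open>The core and the closed operators \<open>S\<close> and \<open>A\<close>\<close>

lemma P_C0: "C0_contraction_semigroup P" and generator_P: "generator P = L"
  using L_generates by (auto simp: generates_semigroup_def)

lemma D_dense: "closure D = UNIV"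
proof -
  have "f \<in> closure D" if f: "f \<in> Domain L" for f
  proof -
    obtain g where "(f, g) \<in> L" using f by (rule DomainE)
    then have "(f, g) \<in> closure (restrict_op L D)" using core by (simp add: core_of_def)
    then have "f \<in> closure (Domain (restrict_op L D))" by (rule closure_Domain_subset)
    moreover have "Domain (restrict_op L D) \<subseteq> D" by (auto simp: restrict_op_def)
    ultimately show ?thesis using closure_mono by blast
  qed
  then have "closure (Domain L) \<subseteq> closure D" by (intro closure_minimal) auto
  then show ?thesis using L_operator(2) by auto
qed

lemma L_single: "single_valued L"
  using L_operator(1) by (simp add: linear_operator_def)

lemma S0_pairing:
  assumes "(f, g) \<in> S0" "(f', g') \<in> S0"
  shows "g \<bullet> f' = 1 * (f \<bullet> g')"
proof -
  have sv: "single_valued S0" using S0_operator(1) by (simp add: linear_operator_def)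
  have "app S0 f = g" "app S0 f' = g'" by (rule app_eqI[OF sv assms(1)], rule app_eqI[OF sv assms(2)])
  then show ?thesis
    using S0_operator(3) DomainI[OF assms(1)] DomainI[OF assms(2)] by (auto simp: symmetric_op_def)
qed

lemma A0_pairing:
  assumes "(f, g) \<in> A0" "(f', g') \<in> A0"
  shows "g \<bullet> f' = - 1 * (f \<bullet> g')"
proof -
  have sv: "single_valued A0" using A0_operator(1) by (simp add: linear_operator_def)
  have "app A0 f = g" "app A0 f' = g'" by (rule app_eqI[OF sv assms(1)], rule app_eqI[OF sv assms(2)])
  then show ?thesis
    using A0_operator(3) DomainI[OF assms(1)] DomainI[OF assms(2)] by (auto simp: antisymmetric_op_def)
qed

lemma S_single: "single_valued S"
  unfolding S_eq by (rule closure_single_valued[OF S0_pairing]) (simp_all add: S0_operator(2) D_dense)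

lemma A_single: "single_valued A"
  unfolding A_eq by (rule closure_single_valued[OF A0_pairing]) (simp_all add: A0_operator(2) D_dense)

lemma S_pairing: "(f, g) \<in> S \<Longrightarrow> (f', g') \<in> S \<Longrightarrow> g \<bullet> f' = f \<bullet> g'"
  using closure_pairing[OF S0_pairing] unfolding S_eq by auto

lemma A_pairing: "(f, g) \<in> A \<Longrightarrow> (f', g') \<in> A \<Longrightarrow> g \<bullet> f' = - (f \<bullet> g')"
  using closure_pairing[OF A0_pairing] unfolding A_eq by auto

lemma S_subspace: "subspace S" and A_subspace: "subspace A"
  using S0_operator(1) A0_operator(1) unfolding S_eq A_eq linear_operator_def
  by (auto intro: closure_subspace)

lemma H1_S: "g \<in> H1 \<Longrightarrow> (g, 0) \<in> S"
  using hyp1 app_eqI[OF S_single] by (force simp: Domain_iff)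

section \<open>Mapping properties of A pi1, its adjoint and \<open>B\<close>\<close>

abbreviation "T \<equiv> A\<pi>1"

lemma T_iff: "(f, k) \<in> T \<longleftrightarrow> (\<pi>1 f, k) \<in> A"
  by (simp add: A\<pi>1_eq precomp_def)

sublocale closed_operator T
proof
  have T_vimage: "T = (\<lambda>p. (\<pi>1 (fst p), snd p)) -` A" by (auto simp: T_iff)
  have "linear (\<lambda>p :: 'h \<times> 'h. (\<pi>1 (fst p), snd p))"
    by (rule linearI) (simp_all add: p1.add p1.scaleR)
  then show "subspace T" unfolding T_vimage using A_subspace by (rule linear_subspace_vimage)
  have "continuous_on UNIV (\<lambda>p :: 'h \<times> 'h. (\<pi>1 (fst p), snd p))"
    by (intro continuous_on_Pair p1.continuous_on continuous_on_fst continuous_on_snd continuous_on_id)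
  then show "closed T"
    unfolding T_vimage by (intro closed_vimage) (simp_all add: A_eq)
qed

lemma T_single: "single_valued T"
  using A_single by (auto simp: single_valued_def T_iff)

text \<open>For h in the core, <A pi1 f, pi1 h> = -<pi1 f, A pi1 h> by antisymmetry, and this
  vanishes by (H2). Density of the core thus extends pi1 A pi1 = 0 to the whole domain of
  \<open>T\<close>.\<close>

lemma T_range: assumes "(f, k) \<in> T" shows "\<pi>1 k = 0"
proof (rule dense_orthogonal_eq_0[OF D_dense])
  fix h assume h: "h \<in> D"
  then obtain g where g: "(\<pi>1 h, g) \<in> A" using hyp2(1) by (auto simp: Domain_iff)
  then have "\<pi>1 g = 0" using hyp2(2)[OF h] app_eqI[OF A_single g] by simp
  have "\<pi>1 k \<bullet> h = k \<bullet> \<pi>1 h" by (rule proj1_inner)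
  also have "\<dots> = - (\<pi>1 f \<bullet> g)" by (rule A_pairing[OF _ g]) (use assms in \<open>simp add: T_iff\<close>)
  also have "\<dots> = 0" using \<open>\<pi>1 g = 0\<close> by (simp add: proj1_inner)
  finally show "\<pi>1 k \<bullet> h = 0" .
qed

text \<open>\<open>T\<close> sees only pi1 f and so vanishes on H2; the range of its adjoint is
  therefore orthogonal to H2.\<close>

lemma adjoint_range: assumes "(g, h) \<in> adjoint_op T" shows "\<pi>2 h = 0"
proof -
  have "(\<pi>2 h, 0) \<in> T"
    using subspace_0[OF A_subspace] by (simp add: T_iff proj_on zero_prod_def)
  from adjoint_opD[OF assms this] have "\<pi>2 h \<bullet> h = 0" by simp
  moreover have "\<pi>2 h \<bullet> h = \<pi>2 h \<bullet> \<pi>2 h"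
    using H_orthogonal[of "\<pi>1 h" "\<pi>2 h"] proj_add[of h] inner_add_right[of "\<pi>2 h" "\<pi>1 h" "\<pi>2 h"]
    by (simp add: inner_commute)
  ultimately show ?thesis by simp
qed

text \<open>By antisymmetry the adjoint sends f in the core to -pi1 (A f). The resulting density of
  its domain is what pins down the bounded extension \<open>B\<close>.\<close>

lemma D_adjoint: "D \<subseteq> Domain (adjoint_op T)"
proof
  fix f assume "f \<in> D"
  then obtain a where fa: "(f, a) \<in> A" using A0_operator(2) closure_subset unfolding A_eq by blast
  have "(f, - \<pi>1 a) \<in> adjoint_op T"
  proof (rule adjoint_opI)
    fix h k assume "(h, k) \<in> T"
    then have "k \<bullet> f = - (\<pi>1 h \<bullet> a)" using fa by (intro A_pairing) (simp_all add: T_iff)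
    then show "k \<bullet> f = h \<bullet> - \<pi>1 a" by (simp add: proj1_inner)
  qed
  then show "f \<in> Domain (adjoint_op T)" by (rule DomainI)
qed

lemma TT_dense: "closure (Domain TT) = UNIV"
  using closure_mono[OF hyp3(1)] D_dense unfolding G_eq by auto

lemma adjoint_dense: "closure (Domain (adjoint_op T)) = UNIV"
  using closure_mono[OF D_adjoint] D_dense by auto

lemma B_solB: "B = solB"
  unfolding B_eq G_eq by (rule bounded_extension_eq[OF TT_dense adjoint_dense])

sublocale G: m_accretive TT by (rule TT_m_accretive[OF TT_dense])

sublocale B: bounded_linear B unfolding B_solB by (rule solB_bounded_linear)

lemma B_H1: "B f \<in> H1"
  unfolding B_solB by (rule mem_H1I, rule adjoint_range, rule solB_adjoint)

lemma B_A: "(B f, solTB f) \<in> A"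
  using solB_mem[of f] proj_on(1)[OF B_H1, of f] by (simp add: T_iff B_solB)

lemma inner_H2: "h \<in> H2 \<Longrightarrow> h \<bullet> f = h \<bullet> \<pi>2 f" and inner_H1: "g \<in> H1 \<Longrightarrow> g \<bullet> f = g \<bullet> \<pi>1 f"
  using H_orthogonal[of "\<pi>1 f" h] H_orthogonal[of g "\<pi>2 f"] proj_add[of f]
    inner_add_right[of h "\<pi>1 f" "\<pi>2 f"] inner_add_right[of g "\<pi>1 f" "\<pi>2 f"]
  by (auto simp: inner_commute)

text \<open>\<open>solTB f\<close> lies in H2, hence is paired with pi2 f only. The energy identity
  bounds its squared norm by that pairing, and Young's inequality gives the constant 1.\<close>

lemma solTB_inner_le: "solTB f \<bullet> f \<le> (norm (\<pi>2 f))\<^sup>2"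
proof -
  have eq: "solTB f \<bullet> f = solTB f \<bullet> \<pi>2 f"
    by (intro inner_H2 mem_H2I T_range[OF solB_mem])
  have "(norm (solTB f))\<^sup>2 \<le> solTB f \<bullet> \<pi>2 f"
    using solB_energy[of f] unfolding eq by (smt (verit) zero_le_power2)
  moreover have "2 * (solTB f \<bullet> \<pi>2 f) \<le> (norm (solTB f))\<^sup>2 + (norm (\<pi>2 f))\<^sup>2"
    using inner_ge_zero[of "solTB f - \<pi>2 f"]
    by (simp add: inner_diff inner_commute power2_norm_eq_inner)
  ultimately show ?thesis unfolding eq by linarith
qed

text \<open>\<open>Q f = \<langle>(I + G)\<^sup>-\<^sup>1 G \<pi>\<^sub>1 f, \<pi>\<^sub>1 f\<rangle>\<close>, since the Yosida approximation at \<open>c = 1\<close> is \<open>G (I + G)\<^sup>-\<^sup>1\<close>.\<close>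

definition "Q f = G.yosida 1 (\<pi>1 f) \<bullet> \<pi>1 f"

text \<open>With y the Yosida value at x = pi1 f, the element w = T (x - y) is mapped to y by the
  adjoint. Since T y = b - w, the pair (y, b - w) solves the system that defines
  \<open>solB b\<close>.\<close>

lemma B_T_proj:
  assumes "(\<pi>1 f, b) \<in> A"
  shows "B b \<bullet> \<pi>1 f = Q f"
proof -
  define x y where "x = \<pi>1 f" and "y = G.yosida 1 x"
  have xb: "(x, b) \<in> T" using assms by (simp add: T_iff x_def proj_on)
  have "(x - 1 *\<^sub>R y, y) \<in> TT" unfolding y_def by (rule G.yosida_mem) simp
  then obtain w where w: "(x - y, w) \<in> T" "(w, y) \<in> adjoint_op T" by auto
  have "solB b = y"
    by (rule solB_eqI[of _ "b - w"]) (use T_diff[OF xb w(1)] w(2) in auto)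
  then show ?thesis by (simp add: Q_def B_solB x_def y_def)
qed

section \<open>Estimates on the core and their extension to the domain of \<open>L\<close>\<close>

lemma core_elements:
  assumes "f \<in> D"
  obtains s a where "(f, s) \<in> S" "(f, a) \<in> A" "(f, s - a) \<in> L"
    "app L f = s - a" "app L f \<bullet> f = s \<bullet> f" "app S f = s"
proof -
  obtain s a where s: "(f, s) \<in> S0" and a: "(f, a) \<in> A0"
    using assms S0_operator(2) A0_operator(2) by blast
  have s': "(f, s) \<in> S" and a': "(f, a) \<in> A"
    using s a closure_subset unfolding S_eq A_eq by blast+
  have "app S0 f = s" "app A0 f = a"
    using s a app_eqI S0_operator(1) A0_operator(1) by (auto simp: linear_operator_def)
  then have L: "app L f = s - a" using L_eq[OF assms] by simp
  obtain l where "(f, l) \<in> L" using assms core by (auto simp: core_of_def Domain_iff)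
  then have "(f, s - a) \<in> L" using app_eqI[OF L_single] L by metis
  moreover have "a \<bullet> f = 0" using A_pairing[OF a' a'] by (simp add: inner_commute)
  ultimately show ?thesis
    using that s' a' L app_eqI[OF S_single s'] by (simp add: inner_diff_left)
qed

text \<open>As S pi1 f = 0, L f = S pi2 f - A pi2 f - A pi1 f. Under \<open>B\<close>, the first two
  terms are bounded by (H3), half of the constant \<open>N\<close> each, and the last one yields -Q
  f. In the other product, \<open>B f\<close> lies in H1, where S vanishes, so only -<B f, A f> = <A
  B f, f> survives, which \<open>solTB_inner_le\<close> bounds.\<close>

lemma B_L_core:
  assumes f: "f \<in> D"
  shows "B (app L f) \<bullet> f + B f \<bullet> app L f
    \<le> N * norm (\<pi>1 f) * norm (\<pi>2 f) + (norm (\<pi>2 f))\<^sup>2 - Q f"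
proof -
  obtain s a where fs: "(f, s) \<in> S" and fa: "(f, a) \<in> A" and L: "app L f = s - a"
    using core_elements[OF f] by metis
  obtain b where b: "(\<pi>1 f, b) \<in> A" using f hyp2(1) by (auto simp: Domain_iff)
  have p2: "\<pi>2 f = f - \<pi>1 f" using proj_add[of f] by (simp add: algebra_simps)
  have "(f - \<pi>1 f, s - 0) \<in> S" using subspace_diff[OF S_subspace fs H1_S[OF proj_H1]] by simp
  then have S2: "app S (\<pi>2 f) = s" unfolding p2 by (intro app_eqI[OF S_single]) simp
  have "(f - \<pi>1 f, a - b) \<in> A" using subspace_diff[OF A_subspace fa b] by simp
  then have A2: "app A (\<pi>2 f) = a - b" unfolding p2 by (rule app_eqI[OF A_single])
  have "B s \<bullet> \<pi>1 f \<le> N / 2 * norm (\<pi>1 f) * norm (\<pi>2 f)"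
    "- (B (a - b) \<bullet> \<pi>1 f) \<le> N / 2 * norm (\<pi>1 f) * norm (\<pi>2 f)"
    using hyp3(3,4)[OF f] by (simp_all add: S2 A2)
  moreover have "B (app L f) \<bullet> f = B s \<bullet> \<pi>1 f - B (a - b) \<bullet> \<pi>1 f - B b \<bullet> \<pi>1 f"
    unfolding inner_H1[OF B_H1, of _ f] L by (simp add: B.diff inner_diff_left)
  ultimately have 1: "B (app L f) \<bullet> f \<le> N * norm (\<pi>1 f) * norm (\<pi>2 f) - Q f"
    by (simp add: B_T_proj[OF b])
  have "B f \<bullet> s = 0" using S_pairing[OF H1_S[OF B_H1] fs, of f] by simp
  moreover have "B f \<bullet> a = - (solTB f \<bullet> f)" using A_pairing[OF B_A fa] by simp
  ultimately have "B f \<bullet> app L f = solTB f \<bullet> f" by (simp add: L inner_diff_right)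
  then show ?thesis using 1 solTB_inner_le[of f] by simp
qed

lemma Q_continuous: "continuous_on UNIV Q"
proof -
  have "bounded_linear (G.yosida 1)" by (rule G.yosida_bounded_linear) simp
  then show ?thesis
    unfolding Q_def
    by (intro continuous_on_inner bounded_linear.continuous_on[OF \<open>bounded_linear (G.yosida 1)\<close>]
        p1.continuous_on continuous_on_id)
qed

lemma Q_nonneg: "0 \<le> Q f"
  using G.yosida_accretive[of 1 "\<pi>1 f"] by (simp add: Q_def inner_commute)

text \<open>Both sides are continuous in (f, l) and \<open>\<Psi>\<close> does not occur, so the
  estimate is a closed condition on the graph and the core property suffices.\<close>

lemma B_L_bound:
  assumes "(f, l) \<in> L"
  shows "B l \<bullet> f + B f \<bullet> l \<le> N * norm (\<pi>1 f) * norm (\<pi>2 f) + (norm (\<pi>2 f))\<^sup>2 - Q f"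
proof -
  let ?C = "{p. B (snd p) \<bullet> fst p + B (fst p) \<bullet> snd p
    \<le> N * norm (\<pi>1 (fst p)) * norm (\<pi>2 (fst p)) + (norm (\<pi>2 (fst p)))\<^sup>2 - Q (fst p)}"
  have "closed ?C"
    by (intro closed_Collect_le continuous_intros p1.continuous_on p2.continuous_on B.continuous_on
        continuous_on_compose2[OF Q_continuous]) auto
  moreover have "restrict_op L D \<subseteq> ?C"
  proof (rule subrelI)
    fix f l assume "(f, l) \<in> restrict_op L D"
    then have "f \<in> D" "app L f = l" using app_eqI[OF L_single] by (auto simp: restrict_op_def)
    then show "(f, l) \<in> ?C" using B_L_core[of f] by simp
  qed
  ultimately have "closure (restrict_op L D) \<subseteq> ?C" by (rule closure_minimal[rotated])
  then show ?thesis using assms core by (auto simp: core_of_def)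
qed

text \<open>Approximation in the graph of \<open>L\<close> gives no control of
  \<open>\<Psi>\<close>, so the sequence of (H4) is used: \<open>q\<close> is continuous in norm,
  and the energies and the values of \<open>\<Psi>\<close> eventually exceed their targets by less
  than any given \<open>d\<close>. For this reason \<open>bound\<close> is required for every real
  upper bound \<open>m\<close> of \<open>\<Psi> f\<close>; it is applied with
  \<open>m + d\<close>.\<close>

lemma extend_from_core:
  assumes q: "continuous_on UNIV q" and "a \<ge> 0" "r \<ge> 0"
    and bound: "\<And>f m. f \<in> D \<Longrightarrow> 0 \<le> m \<Longrightarrow> \<Psi> f \<le> ennreal m \<Longrightarrow> q f \<le> a * - (app L f \<bullet> f) + r * m"
    and fl: "(f, l) \<in> L" and m: "0 \<le> m" "\<Psi> f \<le> ennreal m"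
  shows "q f \<le> a * - (l \<bullet> f) + r * m"
proof -
  have l: "app L f = l" by (rule app_eqI[OF L_single fl])
  obtain F where F: "\<And>n. F n \<in> D" "F \<longlonglongrightarrow> f"
    "limsup (\<lambda>n. ereal (- app L (F n) \<bullet> F n)) \<le> ereal (- l \<bullet> f)" "limsup (\<lambda>n. \<Psi> (F n)) \<le> \<Psi> f"
    using hyp4[of f] fl l by (auto simp: Domain_iff)
  have eps: "q f \<le> a * - (l \<bullet> f) + r * m + (a + r) * d" if d: "d > 0" for d
  proof -
    have "\<forall>\<^sub>F n in sequentially. ereal (- app L (F n) \<bullet> F n) < ereal (- l \<bullet> f + d)"
      by (rule Limsup_lessD, rule le_less_trans[OF F(3)]) (use d in simp)
    moreover have "\<forall>\<^sub>F n in sequentially. \<Psi> (F n) < ennreal (m + d)"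
      by (rule Limsup_lessD, rule le_less_trans[OF F(4)], rule le_less_trans[OF m(2)])
        (use d m(1) in \<open>simp add: ennreal_less_iff\<close>)
    ultimately have "\<forall>\<^sub>F n in sequentially. q (F n) \<le> a * - (l \<bullet> f) + r * m + (a + r) * d"
    proof eventually_elim
      case (elim n)
      have "q (F n) \<le> a * - (app L (F n) \<bullet> F n) + r * (m + d)"
        using elim(2) m(1) d by (intro bound F(1)) auto
      also have "a * - (app L (F n) \<bullet> F n) \<le> a * (- (l \<bullet> f) + d)"
        using elim(1) \<open>a \<ge> 0\<close> by (intro mult_left_mono) auto
      finally show ?case by (simp add: algebra_simps)
    qed
    moreover have "(\<lambda>n. q (F n)) \<longlonglongrightarrow> q f"
      using q F(2) by (intro continuous_on_tendsto_compose[OF q]) auto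
    ultimately show ?thesis by (intro tendsto_upperbound) auto
  qed
  have "((\<lambda>d. a * - (l \<bullet> f) + r * m + (a + r) * d) \<longlongrightarrow> a * - (l \<bullet> f) + r * m + (a + r) * 0) (at_right 0)"
    by (intro tendsto_intros)
  moreover have "\<forall>\<^sub>F d in at_right 0. q f \<le> a * - (l \<bullet> f) + r * m + (a + r) * d"
    by (rule eventually_mono[OF eventually_at_right_less]) (rule eps)
  ultimately have "q f \<le> a * - (l \<bullet> f) + r * m + (a + r) * 0"
    by (rule tendsto_lowerbound) simp
  then show ?thesis by simp
qed

lemma L_dissipative: "(f, l) \<in> L \<Longrightarrow> l \<bullet> f \<le> 0"
  using generator_dissipative[OF P_C0, of f l] generator_P by (simp add: inner_commute)

lemma weak_Poincare2_extended:
  assumes r: "r > 0" and "(f, l) \<in> L" "0 \<le> m" "\<Psi> f \<le> ennreal m"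
  shows "(norm (\<pi>2 f))\<^sup>2 \<le> \<alpha>2 r * - (l \<bullet> f) + r * m"
proof (rule extend_from_core[of "\<lambda>f. (norm (\<pi>2 f))\<^sup>2", OF _ _ _ _ assms(2-4)])
  show "continuous_on UNIV (\<lambda>f. (norm (\<pi>2 f))\<^sup>2)"
    by (intro continuous_intros p2.continuous_on)
  show "0 \<le> \<alpha>2 r" using \<alpha>2(2)[OF r] by simp
  fix f m assume f: "f \<in> D" and m: "0 \<le> m" "\<Psi> f \<le> ennreal m"
  obtain s a where sa: "(f, s - a) \<in> L" "app L f = s - a" "app L f \<bullet> f = s \<bullet> f" "app S f = s"
    using core_elements[OF f] by metis
  \<comment> \<open>Antisymmetry gives <A f, f> = 0, so the energy <-S f, f> of the hypothesis is
    <-L f, f> on the core. Its sign matters because \<open>ennreal\<close> sends negative reals to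
    0.\<close>
  then have "s \<bullet> f \<le> 0" using L_dissipative[OF sa(1)] by simp
  then have "\<alpha>2 r * (s \<bullet> f) \<le> 0" using \<alpha>2(2)[OF r] by (intro mult_nonneg_nonpos) auto
  then show "(norm (\<pi>2 f))\<^sup>2 \<le> \<alpha>2 r * - (app L f \<bullet> f) + r * m"
    using ennreal_le_add_mult_boundD[OF weak_Poincare2[OF r f] m(2)] \<alpha>2(2)[OF r] r m(1) sa by simp
qed (use r in simp)

text \<open>\<open>T\<close> sees only pi1 f, so pi1 f lies in the domain of \<open>G\<close> along
  with f. Its orbit under the semigroup of -G stays in H1, since the derivative lies in the range of
  the adjoint. Hence pi1 fixes the orbit, \<open>\<Psi>\<close> on it is at most
  \<open>\<Psi> f\<close>, and the hypothesis holds at every time, as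
  \<open>weak_Poincare_resolvent\<close> demands. The factor 3 comes from \<alpha>1 + 2 \<le> 3
  \<alpha>1.\<close>

lemma weak_Poincare1_core:
  assumes r: "r > 0" and f: "f \<in> D" and m: "0 \<le> m" "\<Psi> f \<le> ennreal m"
  shows "(norm (\<pi>1 f))\<^sup>2 \<le> 3 * \<alpha>1 r * Q f + r * m"
proof -
  let ?x = "\<pi>1 f" and ?E = "exp_semigroup (neg_op TT)"
  have "f \<in> Domain TT" using f hyp3(1) by (auto simp only: G_eq)
  then obtain g where "(f, g) \<in> TT" by (rule DomainE)
  then have xg: "(?x, g) \<in> TT" by (auto simp: T_iff proj_on)
  define u where "u = (\<lambda>t. G.semigroup t ?x)"
  have gen: "generates_semigroup (neg_op TT) G.semigroup" by (rule G.generates_semigroup)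
  then have C0: "C0_contraction_semigroup G.semigroup" and gen_eq: "generator G.semigroup = neg_op TT"
    by (auto simp: generates_semigroup_def)
  have "Domain (neg_op TT) = Domain TT" by (auto simp: neg_op_def Domain_iff)
  then have exp_eq: "?E t ?x = u t" if "t \<ge> 0" for t
    unfolding u_def using TT_dense by (intro exp_semigroup_eq[OF gen _ that]) simp
  have xg': "(?x, - g) \<in> generator G.semigroup" unfolding gen_eq using xg by (auto simp: neg_op_def)
  have u_H1: "u t \<in> H1" if "t \<ge> 0" for t
  proof (rule mem_H1I)
    have "norm (\<pi>2 (u t)) \<le> norm (\<pi>2 (u 0))"
    proof (rule norm_nonincreasing_halfline[of "\<lambda>t. \<pi>2 (u t)" "\<lambda>t. 0", OF _ _ that])
      fix t :: real assume t: "t \<ge> 0"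
      have "(u t, G.semigroup t (- g)) \<in> neg_op TT"
        using generator_invariant[OF C0 xg' t] by (simp add: gen_eq u_def)
      then have "\<pi>2 (G.semigroup t (- g)) = 0"
        using adjoint_range by (auto simp: neg_op_def p2.neg)
      then show "((\<lambda>t. \<pi>2 (u t)) has_vector_derivative 0) (at t within {0..})"
        using p2.has_vector_derivative[OF semigroup_derivative[OF C0 xg' t]] by (simp add: u_def)
    qed simp
    also have "u 0 = ?x" by (simp add: u_def C0_zero[OF C0])
    finally show "\<pi>2 (u t) = 0" by (simp add: proj_on)
  qed
  have "(norm ?x)\<^sup>2 \<le> (\<alpha>1 r + 2) * (G.yosida 1 ?x \<bullet> ?x) + r * m"
  proof (rule weak_Poincare_resolvent[OF TT_dense _ \<alpha>1(2)[OF r]])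
    show "?x \<in> Domain TT" using xg by (rule DomainI)
    fix t k assume t: "t \<ge> 0" and k: "(?E t ?x, k) \<in> T"
    have "\<Psi> (\<pi>1 (u t)) \<le> \<Psi> (u t)" by (rule \<Psi>_\<pi>1)
    also have "\<dots> = \<Psi> (exp_semigroup (neg_op G) t ?x)" by (simp add: exp_eq[OF t] G_eq)
    also have "\<dots> \<le> \<Psi> ?x" by (rule \<Psi>_exp_G[OF t])
    also have "\<dots> \<le> \<Psi> f" by (rule \<Psi>_\<pi>1)
    also note m(2)
    finally have \<Psi>_u: "\<Psi> (\<pi>1 (u t)) \<le> ennreal m" .
    have k': "(u t, k) \<in> T" using k by (simp add: exp_eq[OF t])
    then have "ennreal ((norm (\<pi>1 (u t)))\<^sup>2) \<le> ennreal (\<alpha>1 r * (norm k)\<^sup>2) + ennreal r * \<Psi> (\<pi>1 (u t))"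
      using weak_Poincare1[OF r DomainI[OF k']] app_eqI[OF T_single k'] by simp
    then have "(norm (\<pi>1 (u t)))\<^sup>2 \<le> \<alpha>1 r * (norm k)\<^sup>2 + r * m"
      by (rule ennreal_le_add_mult_boundD) (use \<Psi>_u r m(1) \<alpha>1(2)[OF r] in auto)
    then show "(norm (?E t ?x))\<^sup>2 \<le> \<alpha>1 r * (norm k)\<^sup>2 + r * m"
      using proj_on(1)[OF u_H1[OF t]] by (simp add: exp_eq[OF t])
  qed
  also have "(\<alpha>1 r + 2) * (G.yosida 1 ?x \<bullet> ?x) \<le> 3 * \<alpha>1 r * Q f"
    using \<alpha>1(2)[OF r] Q_nonneg[of f] unfolding Q_def[symmetric] by (intro mult_right_mono) auto
  finally show ?thesis by simp
qed

text \<open>\<open>extend_from_core\<close> with energy weight 0: \<open>Q\<close> is already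
  continuous in norm.\<close>

lemma weak_Poincare1_extended:
  assumes r: "r > 0" and "(f, l) \<in> L" "0 \<le> m" "\<Psi> f \<le> ennreal m"
  shows "(norm (\<pi>1 f))\<^sup>2 \<le> 3 * \<alpha>1 r * Q f + r * m"
proof -
  have "(norm (\<pi>1 f))\<^sup>2 - 3 * \<alpha>1 r * Q f \<le> 0 * - (l \<bullet> f) + r * m"
  proof (rule extend_from_core[of "\<lambda>f. (norm (\<pi>1 f))\<^sup>2 - 3 * \<alpha>1 r * Q f", OF _ _ _ _ assms(2-4)])
    show "continuous_on UNIV (\<lambda>f. (norm (\<pi>1 f))\<^sup>2 - 3 * \<alpha>1 r * Q f)"
      by (intro continuous_intros p1.continuous_on Q_continuous)
    show "(norm (\<pi>1 f))\<^sup>2 - 3 * \<alpha>1 r * Q f \<le> 0 * - (app L f \<bullet> f) + r * m"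
      if "f \<in> D" "0 \<le> m" "\<Psi> f \<le> ennreal m" for f m
      using weak_Poincare1_core[OF r that] by simp
  qed (use r in auto)
  then show ?thesis by simp
qed

lemma decay:
  assumes r: "r > 0" and fl: "(f, l) \<in> L" and m: "0 \<le> m" "\<Psi> f \<le> ennreal m" and t: "t \<ge> 0"
    and rate: "1 / (30 * N\<^sup>2) * t \<ge> (\<alpha>1 r)\<^sup>2 * \<alpha>2 (r / (\<alpha>1 r)\<^sup>2) * ln (1 / r)"
  shows "(norm (P t f))\<^sup>2 \<le> 128 * N\<^sup>2 * r * ((norm f)\<^sup>2 + m)"
proof -
  define a c where "a = \<alpha>1 r" and "c = \<alpha>2 (r / a\<^sup>2)"
  have a: "a \<ge> 1" unfolding a_def by (rule \<alpha>1(2)[OF r])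
  then have ra: "r / a\<^sup>2 > 0" using r by simp
  then have c: "c \<ge> 1" unfolding c_def by (rule \<alpha>2(2))
  have N2: "1 \<le> N\<^sup>2" using hyp3(2) by simp
  \<comment> \<open>The two weights of \<open>hypocoercive_balance\<close>. As |<B g, g>| \<le>
    |g|^2, the bound \<delta> \<le> 1/5 keeps \<open>F\<close> comparable to the squared
    norm.\<close>
  define \<delta> \<kappa> where "\<delta> = 1 / (5 * N\<^sup>2 * a * c)" and "\<kappa> = 1 / (30 * N\<^sup>2 * a\<^sup>2 * c)"
  have \<delta>: "0 < \<delta>" "\<delta> \<le> 1 / 5"
  proof -
    have "1 * 1 \<le> N\<^sup>2 * a" using N2 a by (intro mult_mono) auto
    then have "1 * 1 \<le> N\<^sup>2 * a * c" using c by (intro mult_mono) auto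
    then show "0 < \<delta>" "\<delta> \<le> 1 / 5" by (auto simp: \<delta>_def mult.assoc divide_simps)
  qed
  have "0 < N" using hyp3(2) by simp
  then have \<kappa>: "0 < \<kappa>" using a c by (simp add: \<kappa>_def)
  have B_le: "\<bar>B g \<bullet> g\<bar> \<le> (norm g)\<^sup>2" for g
  proof -
    have "\<bar>B g \<bullet> g\<bar> \<le> norm (B g) * norm g" by (rule Cauchy_Schwarz_ineq2)
    also have "\<dots> \<le> norm g * norm g"
      using solB_norm_le[of g] by (intro mult_right_mono) (simp_all add: B_solB)
    finally show ?thesis by (simp add: power2_eq_square)
  qed
  define F where "F s = (norm (P s f))\<^sup>2 / 2 + \<delta> * (B (P s f) \<bullet> P s f)" for s
  define F' where "F' s = P s f \<bullet> P s l + \<delta> * (B (P s l) \<bullet> P s f + B (P s f) \<bullet> P s l)" for s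
  have "\<delta> * \<bar>B g \<bullet> g\<bar> \<le> 1 / 5 * (norm g)\<^sup>2" for g
    using \<delta> B_le[of g] by (intro mult_mono) auto
  then have dB: "\<bar>\<delta> * (B g \<bullet> g)\<bar> \<le> 1 / 5 * (norm g)\<^sup>2" for g
    using \<delta>(1) by (simp add: abs_mult)
  have F_le: "F s \<le> (norm (P s f))\<^sup>2" for s
    using dB[of "P s f"] zero_le_power2[of "norm (P s f)"] unfolding F_def by linarith
  have "n \<le> 4 * (n / 2 + x)" if "\<bar>x\<bar> \<le> 1 / 5 * n" "0 \<le> n" for n x :: real
    using that abs_ge_minus_self[of x] by simp
  from this[OF dB zero_le_power2] have F_ge: "(norm (P s f))\<^sup>2 \<le> 4 * F s" for s
    unfolding F_def .
  have decay: "F t \<le> 32 * N\<^sup>2 * r * m + exp (- \<kappa> * t) * (F 0 - 32 * N\<^sup>2 * r * m)"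
  proof (rule halfline_gronwall[OF _ _ t])
    fix s :: real assume s: "s \<ge> 0"
    have d: "((\<lambda>s. P s f) has_vector_derivative P s l) (at s within {0..})"
      by (rule semigroup_derivative[OF P_C0 _ s]) (simp add: generator_P fl)
    have "((\<lambda>s. B (P s f) \<bullet> P s f) has_vector_derivative B (P s f) \<bullet> P s l + B (P s l) \<bullet> P s f)
        (at s within {0..})"
      by (rule bounded_bilinear.has_vector_derivative[OF bounded_bilinear_inner B.has_vector_derivative[OF d] d])
    then have "((\<lambda>s. B (P s f) \<bullet> P s f) has_real_derivative B (P s f) \<bullet> P s l + B (P s l) \<bullet> P s f)
        (at s within {0..})"
      by (simp add: has_real_derivative_iff_has_vector_derivative)
    note dB' = DERIV_cmult[OF this, of \<delta>]
    show "(F has_real_derivative F' s) (at s within {0..})"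
      unfolding F_def F'_def
      by (rule DERIV_cong[OF DERIV_add[OF DERIV_cdivide[OF norm_square_derivative[OF d]] dB']])
        (simp add: add.commute)
    have mem: "(P s f, P s l) \<in> L"
      using generator_invariant[OF P_C0 _ s, of f l] fl by (simp add: generator_P)
    have \<Psi>: "\<Psi> (P s f) \<le> ennreal m" using \<Psi>_P[OF s] m(2) by (rule order_trans)
    have "- (- (P s l \<bullet> P s f)) + 1 / (5 * N\<^sup>2 * a * c) * (B (P s l) \<bullet> P s f + B (P s f) \<bullet> P s l)
        \<le> 1 / (30 * N\<^sup>2 * a\<^sup>2 * c) * (32 * N\<^sup>2 * r * m - ((norm (\<pi>1 (P s f)))\<^sup>2 + (norm (\<pi>2 (P s f)))\<^sup>2))"
    proof (rule hypocoercive_balance[OF a c hyp3(2) _ m(1)])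
      show "(norm (\<pi>1 (P s f)))\<^sup>2 \<le> 3 * a * Q (P s f) + r * m"
        unfolding a_def by (rule weak_Poincare1_extended[OF r mem m(1) \<Psi>])
      show "(norm (\<pi>2 (P s f)))\<^sup>2 \<le> c * - (P s l \<bullet> P s f) + r / a\<^sup>2 * m"
        unfolding c_def by (rule weak_Poincare2_extended[OF ra mem m(1) \<Psi>])
    qed (use r B_L_bound[OF mem] in auto)
    then have "F' s \<le> \<kappa> * (32 * N\<^sup>2 * r * m - (norm (P s f))\<^sup>2)"
      by (simp add: F'_def \<delta>_def \<kappa>_def norm_decomposition[symmetric] inner_commute)
    also have "\<dots> \<le> \<kappa> * (32 * N\<^sup>2 * r * m - F s)"
      using F_le[of s] \<kappa> by (intro mult_left_mono) auto
    finally show "F' s \<le> \<kappa> * (32 * N\<^sup>2 * r * m - F s)" .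
  qed
  \<comment> \<open>This is the hypothesis \<open>rate\<close> divided by
    \<open>a\<^sup>2 * c\<close>. It gives exp (-\<kappa> t) \<le> r, so the initial energy is
    damped to the same order r as the \<open>\<Psi>\<close> term.\<close>
  have rate': "ln (1 / r) \<le> \<kappa> * t"
  proof -
    have "a\<^sup>2 * c > 0" using a c by simp
    moreover have "a\<^sup>2 * c * ln (1 / r) \<le> a\<^sup>2 * c * (\<kappa> * t)"
      using rate a c N2 by (simp add: a_def[symmetric] c_def[symmetric] \<kappa>_def)
    ultimately show ?thesis by (simp only: mult_le_cancel_left_pos)
  qed
  have "exp (- \<kappa> * t) \<le> exp (- ln (1 / r))" using rate' by simp
  also have "\<dots> = r" using r by (simp add: ln_div)
  finally have er: "exp (- \<kappa> * t) \<le> r" .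
  have F0: "0 \<le> F 0" using F_ge[of 0] zero_le_power2[of "norm (P 0 f)"] by linarith
  have "exp (- \<kappa> * t) * F 0 \<le> r * (norm f)\<^sup>2"
    using er F0 F_le[of 0] r by (intro mult_mono) (auto simp: C0_zero[OF P_C0])
  moreover have "0 \<le> exp (- \<kappa> * t) * (32 * N\<^sup>2 * r * m)" using r m(1) by simp
  ultimately have "F t \<le> 32 * N\<^sup>2 * r * m + r * (norm f)\<^sup>2" using decay by (simp add: algebra_simps)
  also have "r * (norm f)\<^sup>2 \<le> 32 * N\<^sup>2 * r * (norm f)\<^sup>2"
    using N2 r by (intro mult_right_mono) auto
  finally show ?thesis using F_ge[of t] by (simp add: algebra_simps)
qed

end

section \<open>The rate function\<close>

text \<open>The weight in front of the logarithm is at least 1, so ln (1 / r) \<le> c t whichever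
  sign the logarithm has. The infimum in \<open>rate\<close> is thus positive, which matters when
  \<open>\<Psi> f = \<infinity>\<close>: in \<open>ennreal\<close> the product of 0 and \<infinity>
  is 0, and a vanishing rate would claim P t f = 0.\<close>

lemma rate_set_lower_bound:
  assumes "\<And>r. r > 0 \<Longrightarrow> \<alpha>1 r \<ge> (1 :: real)" "\<And>r. r > 0 \<Longrightarrow> \<alpha>2 r \<ge> (1 :: real)"
    and r: "r > 0" and le: "c * t \<ge> (\<alpha>1 r)\<^sup>2 * \<alpha>2 (r / (\<alpha>1 r)\<^sup>2) * ln (1 / r)" and ct: "0 \<le> c * t"
  shows "exp (- (c * t)) \<le> r"
proof -
  have a: "\<alpha>1 r \<ge> 1" by (rule assms(1)[OF r])
  then have "\<alpha>2 (r / (\<alpha>1 r)\<^sup>2) \<ge> 1" using r by (intro assms(2)) auto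
  then have w: "1 * 1 \<le> (\<alpha>1 r)\<^sup>2 * \<alpha>2 (r / (\<alpha>1 r)\<^sup>2)" using a by (intro mult_mono) auto
  have "ln (1 / r) \<le> c * t"
  proof (cases "ln (1 / r) \<ge> 0")
    case True
    then show ?thesis using mult_right_mono[OF w True] le by simp
  qed (use ct in simp)
  then have "exp (- (c * t)) \<le> exp (- ln (1 / r))" by simp
  also have "\<dots> = r" using r by (simp add: ln_div)
  finally show ?thesis .
qed

text \<open>A fixed \<open>r\<close> is admissible for all t \<ge> max 0 (w / c2), so the infimum is
  eventually at most \<open>r\<close>; \<open>r\<close> is chosen with c1 r = e / 2.\<close>

lemma rate_tendsto_0:
  assumes \<alpha>1: "\<And>r. r > 0 \<Longrightarrow> \<alpha>1 r \<ge> (1 :: real)" and \<alpha>2: "\<And>r. r > 0 \<Longrightarrow> \<alpha>2 r \<ge> (1 :: real)"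
    and c: "c1 > 0" "c2 > 0"
  shows "(rate \<alpha>1 \<alpha>2 c1 c2 \<longlongrightarrow> 0) at_top"
proof (rule tendstoI)
  fix e :: real assume e: "e > 0"
  define r where "r = e / (2 * c1)"
  define w where "w = (\<alpha>1 r)\<^sup>2 * \<alpha>2 (r / (\<alpha>1 r)\<^sup>2) * ln (1 / r)"
  have r: "r > 0" "c1 * r < e" using e c by (auto simp: r_def)
  have "\<forall>\<^sub>F t in at_top. max 0 (w / c2) \<le> t" by (rule eventually_ge_at_top)
  then show "\<forall>\<^sub>F t in at_top. dist (rate \<alpha>1 \<alpha>2 c1 c2 t) 0 < e"
  proof eventually_elim
    case (elim t)
    let ?S = "{r. r > 0 \<and> c2 * t \<ge> (\<alpha>1 r)\<^sup>2 * \<alpha>2 (r / (\<alpha>1 r)\<^sup>2) * ln (1 / r)}"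
    have "w \<le> c2 * t" using elim c by (simp add: pos_divide_le_eq mult.commute)
    then have "r \<in> ?S" using r by (simp add: w_def)
    then have "0 \<le> Inf ?S" "Inf ?S \<le> r"
      by (auto intro!: cInf_greatest cInf_lower bdd_belowI[of _ 0] intro: less_imp_le)
    then have "0 \<le> c1 * Inf ?S" "c1 * Inf ?S \<le> c1 * r" using c by auto
    then show ?case using r by (simp add: rate_def)
  qed
qed

theorem theorem2p1:
  fixes P :: "real \<Rightarrow> 'h::{real_inner, banach} \<Rightarrow> 'h"
    and L S0 A0 S A A\<pi>1 G :: "'h operator"
    and B \<pi>1 \<pi>2 :: "'h \<Rightarrow> 'h"
    and D H1 H2 :: "'h set"
    and \<Psi> :: "'h \<Rightarrow> ennreal"
    and \<alpha>1 \<alpha>2 :: "real \<Rightarrow> real"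
    and N :: real
  assumes separable: "separable_space (euclidean :: 'h topology)"
    and L_operator: "linear_operator L" "closure (Domain L) = UNIV"
    and L_generates: "generates_semigroup L P"
    and core: "core_of D L"
    and S0_operator: "linear_operator S0" "Domain S0 = D" "symmetric_op S0"
    and A0_operator: "linear_operator A0" "Domain A0 = D" "antisymmetric_op A0"
    and L_eq: "\<And>f. f \<in> D \<Longrightarrow> app L f = app S0 f - app A0 f"
    and S_eq: "S = closure S0"
    and A_eq: "A = closure A0"
    and decomposition: "orthogonal_decomposition H1 H2 \<pi>1 \<pi>2"
    and \<Psi>_dense: "closure {f. \<Psi> f < \<infinity>} = UNIV"
    and A\<pi>1_eq: "A\<pi>1 = precomp A \<pi>1"
    and G_eq: "G = A\<pi>1 O adjoint_op A\<pi>1"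
    and B_eq: "B = bounded_extension (adjoint_op A\<pi>1 O (id_plus G)\<inverse>)"
    and hyp1: "H1 \<subseteq> {f \<in> Domain S. app S f = 0}"
    and hyp2: "\<pi>1 ` D \<subseteq> Domain A" "\<And>f. f \<in> D \<Longrightarrow> \<pi>1 (app A (\<pi>1 f)) = 0"
    and hyp3: "D \<subseteq> Domain G" "N \<ge> 1"
      "\<And>f. f \<in> D \<Longrightarrow> B (app S (\<pi>2 f)) \<bullet> \<pi>1 f \<le> N / 2 * norm (\<pi>1 f) * norm (\<pi>2 f)"
      "\<And>f. f \<in> D \<Longrightarrow> - (B (app A (\<pi>2 f)) \<bullet> \<pi>1 f) \<le> N / 2 * norm (\<pi>1 f) * norm (\<pi>2 f)"
    and hyp4: "\<And>f. f \<in> Domain L \<Longrightarrow>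
      \<exists>F :: nat \<Rightarrow> 'h. (\<forall>n. F n \<in> D) \<and> F \<longlonglongrightarrow> f \<and>
        limsup (\<lambda>n. ereal (- app L (F n) \<bullet> F n)) \<le> ereal (- app L f \<bullet> f) \<and>
        limsup (\<lambda>n. \<Psi> (F n)) \<le> \<Psi> f"
    and \<Psi>_P: "\<And>t f. t \<ge> 0 \<Longrightarrow> \<Psi> (P t f) \<le> \<Psi> f"
    and \<Psi>_exp_G: "\<And>t f. t \<ge> 0 \<Longrightarrow> \<Psi> (exp_semigroup (neg_op G) t f) \<le> \<Psi> f"
    and \<Psi>_\<pi>1: "\<And>f. \<Psi> (\<pi>1 f) \<le> \<Psi> f"
    and \<alpha>1: "antimono_on {0<..} \<alpha>1" "\<And>r. r > 0 \<Longrightarrow> \<alpha>1 r \<ge> 1"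
    and \<alpha>2: "antimono_on {0<..} \<alpha>2" "\<And>r. r > 0 \<Longrightarrow> \<alpha>2 r \<ge> 1"
    and weak_Poincare1: "\<And>r f. r > 0 \<Longrightarrow> f \<in> Domain A\<pi>1 \<Longrightarrow>
      ennreal ((norm (\<pi>1 f))\<^sup>2) \<le> ennreal (\<alpha>1 r * (norm (app A\<pi>1 f))\<^sup>2) + ennreal r * \<Psi> (\<pi>1 f)"
    and weak_Poincare2: "\<And>r f. r > 0 \<Longrightarrow> f \<in> D \<Longrightarrow>
      ennreal ((norm (\<pi>2 f))\<^sup>2) \<le> ennreal (\<alpha>2 r * (- app S f \<bullet> f)) + ennreal r * \<Psi> f"
  shows "\<exists>c1>0. \<exists>c2>0.
      (\<forall>t\<ge>0. \<forall>f \<in> Domain L.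
         ennreal ((norm (P t f))\<^sup>2) \<le> ennreal (rate \<alpha>1 \<alpha>2 c1 c2 t) * (ennreal ((norm f)\<^sup>2) + \<Psi> f)) \<and>
      (rate \<alpha>1 \<alpha>2 c1 c2 \<longlongrightarrow> 0) at_top"
proof -
  interpret hypocoercive P L S0 A0 S A A\<pi>1 G B \<pi>1 \<pi>2 D H1 H2 \<Psi> \<alpha>1 \<alpha>2 N
    using assms by (intro hypocoercive.intro)
  let ?c1 = "128 * N\<^sup>2" and ?c2 = "1 / (30 * N\<^sup>2)"
  have c: "?c1 > 0" "?c2 > 0" using hyp3(2) by auto
  have "ennreal ((norm (P t f))\<^sup>2) \<le> ennreal (rate \<alpha>1 \<alpha>2 ?c1 ?c2 t) * (ennreal ((norm f)\<^sup>2) + \<Psi> f)"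
    if t: "t \<ge> 0" and f: "f \<in> Domain L" for t f
  proof -
    obtain l where fl: "(f, l) \<in> L" using f by (rule DomainE)
    define Rs where "Rs = {r. r > 0 \<and> ?c2 * t \<ge> (\<alpha>1 r)\<^sup>2 * \<alpha>2 (r / (\<alpha>1 r)\<^sup>2) * ln (1 / r)}"
    have rate: "rate \<alpha>1 \<alpha>2 ?c1 ?c2 t = ?c1 * Inf Rs" by (simp add: rate_def Rs_def)
    have ct: "0 \<le> ?c2 * t" using c t by (intro mult_nonneg_nonneg) auto
    then have "1 \<in> Rs" by (simp add: Rs_def)
    then have ne: "Rs \<noteq> {}" by auto
    have "exp (- (?c2 * t)) \<le> Inf Rs"
      by (rule cInf_greatest[OF ne])
        (use rate_set_lower_bound[OF \<alpha>1(2) \<alpha>2(2) _ _ ct] in \<open>auto simp: Rs_def\<close>)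
    then have "0 < Inf Rs" using exp_gt_zero by (rule less_le_trans[rotated])
    then have pos: "0 < rate \<alpha>1 \<alpha>2 ?c1 ?c2 t" unfolding rate by (rule mult_pos_pos[OF c(1)])
    show ?thesis
    proof (cases "\<Psi> f = \<infinity>")
      case True
      then show ?thesis using pos by (simp add: ennreal_mult_top)
    next
      case False
      define m where "m = enn2real (\<Psi> f)"
      have m: "0 \<le> m" "\<Psi> f = ennreal m" using False by (auto simp: m_def less_top)
      let ?X = "(norm f)\<^sup>2 + m"
      have le: "(norm (P t f))\<^sup>2 \<le> ?c1 * r * ?X" if "r \<in> Rs" for r
        using decay[OF _ fl m(1) eq_refl[OF m(2)] t, of r] that by (simp add: Rs_def)
      have "(norm (P t f))\<^sup>2 \<le> ?c1 * Inf Rs * ?X"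
      proof (cases "?X = 0")
        case True
        then show ?thesis using le[OF \<open>1 \<in> Rs\<close>] by simp
      next
        case False
        then have X: "?X > 0" using m(1) zero_le_power2[of "norm f"] by linarith
        \<comment> \<open>After division by \<open>?c1 * ?X\<close> the left side is a lower bound
          of \<open>Rs\<close>, which turns the estimates for the single \<open>r\<close> into one
          for the infimum.\<close>
        have "(norm (P t f))\<^sup>2 / (?c1 * ?X) \<le> Inf Rs"
        proof (rule cInf_greatest[OF ne])
          fix r assume "r \<in> Rs"
          from le[OF this] show "(norm (P t f))\<^sup>2 / (?c1 * ?X) \<le> r"
            using c X by (subst pos_divide_le_eq) (auto intro: mult_pos_pos simp: ac_simps)
        qed
        then show ?thesis using c X by (subst (asm) pos_divide_le_eq) (auto intro: mult_pos_pos simp: ac_simps)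
      qed
      then have "ennreal ((norm (P t f))\<^sup>2) \<le> ennreal (rate \<alpha>1 \<alpha>2 ?c1 ?c2 t * ?X)"
        unfolding rate by (rule ennreal_leI)
      also have "\<dots> = ennreal (rate \<alpha>1 \<alpha>2 ?c1 ?c2 t) * (ennreal ((norm f)\<^sup>2) + \<Psi> f)"
        using pos m by (simp add: ennreal_mult ennreal_plus less_imp_le)
      finally show ?thesis .
    qed
  qed
  then show ?thesis
    using c rate_tendsto_0[of \<alpha>1 \<alpha>2, OF \<alpha>1(2) \<alpha>2(2) c]
    by (intro exI[of _ ?c1] exI[of _ ?c2] conjI allI ballI impI)
qed

end
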